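(* Let $(G,X)$ be a self-similar group with $|X|=d\ge 2$, let $\psi:H\to H^X$ be a $d$-fold similarity of a Hilbert space $H$, and let $\pi:O_d=\langle a_x\rangle_{x\in X}\to B(H)$ be the representation of the Cuntz algebra associated with $\psi$. A unitary representation $\rho$ of $G$ on $H$ is self-similar (with respect to $\psi$) if and only if $\rho$ and $\pi$ generate a representation of the Cuntz-Pimsner algebra $O_G$, i.e., there is a representation of $O_G$ on $H$ sending each $g\in G$ to $\rho(g)$ and each $a_x$ to $\pi(a_x)$. Consequently, self-similar representations of $G$ are precisely the restrictions onto $G$ of representations of $O_G$.
   Context: Let $X$ be a finite alphabet, $d=|X|\ge 2$, and let $X^*$ be the set of finite words over $X$, viewed as the vertex set of a rooted tree (root the empty word, $v$ adjacent to $vx$ for $x\in X$). A self-similar group $(G,X)$ is a group $G$ acting faithfully on the rooted tree $X^*$ such that for every $g\in G$ and $x\in X$ there exist $h\in G$ and $y\in X$ with $g(xw)=yh(w)$ for all $w\in X^*$; then $y=g(x)$ and one writes $h=g|_x$. A $d$-fold similarity of an infinite-dimensional Hilbert space $H$ is an isomorphism of Hilbert spaces (surjective linear isometry) $\psi:H\to H^X=\bigoplus_{x\in X}H$. The Cuntz algebra $O_d$ is the universal unital $C^*$-algebra generated by $a_x$, $x\in X$, with $a_x^*a_x=1$ for all $x$ and $\sum_{x\in X}a_xa_x^*=1$. The representation of $O_d$ associated with $\psi$ sends $a_x$ to the isometry $T_x$ given by $T_x(\xi)=\psi^{-1}(\text{the vector with }\xi\text{ in coordinate }x\text{ and }0\text{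 elsewhere})$. A unitary representation $\rho$ of $G$ on $H$ is self-similar (with respect to $\psi$) if $\rho(g)T_x=T_y\rho(h)$ whenever $g,h\in G$, $x,y\in X$ satisfy $g(xw)=yh(w)$ for all $w\in X^*$; it is called self-similar if it is self-similar with respect to some $d$-fold similarity of $H$. The (universal) Cuntz-Pimsner algebra $O_G$ is the universal unital $C^*$-algebra generated by $G$ (as unitaries) and $a_x$, $x\in X$, subject to: all relations of $G$; $a_x^*a_x=1$ for all $x\in X$ and $\sum_{x\in X}a_xa_x^*=1$; and $ga_x=a_yh$ whenever $g(xw)=yh(w)$ for all $w\in X^*$ (that is, $y=g(x)$, $h=g|_x$). Representations of $C^*$-algebras are unital $*$-representations, on nonzero Hilbert spaces. *)

theory Defs
  imports "HOL-Analysis.Analysis" "HOL-Algebra.Algebra" "HOL-Library.Poly_Mapping"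
begin

section \<open>Complex Hilbert spaces\<close>

text \<open>
  The inner product is linear in the first argument. The norm, and with it the metric and
  completeness, come from the superclass; the last axiom ties them to the inner product and
  makes it positive definite.
\<close>

class complex_hilbert_space = banach +
  fixes scaleC :: "complex \<Rightarrow> 'a \<Rightarrow> 'a" (infixr \<open>*\<^sub>C\<close> 75)
    and cinner :: "'a \<Rightarrow> 'a \<Rightarrow> complex"
  assumes scaleC_add_right: "a *\<^sub>C (x + y) = a *\<^sub>C x + a *\<^sub>C y"
    and scaleC_add_left: "(a + b) *\<^sub>C x = a *\<^sub>C x + b *\<^sub>C x"
    and scaleC_scaleC: "a *\<^sub>C (b *\<^sub>C x) = (a * b) *\<^sub>C x"
    and scaleC_of_real: "complex_of_real r *\<^sub>C x = r *\<^sub>R x"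
    and cinner_commute: "cinner x y = cnj (cinner y x)"
    and cinner_add_left: "cinner (x + y) z = cinner x z + cinner y z"
    and cinner_scaleC_left: "cinner (a *\<^sub>C x) y = a * cinner x y"
    and cinner_self: "cinner x x = complex_of_real ((norm x)\<^sup>2)"

global_interpretation complex_vector:
  vector_space "scaleC :: complex \<Rightarrow> 'a \<Rightarrow> 'a::complex_hilbert_space"
proof
  fix a b :: complex and x y :: 'a
  show "a *\<^sub>C (x + y) = a *\<^sub>C x + a *\<^sub>C y" by (rule scaleC_add_right)
  show "(a + b) *\<^sub>C x = a *\<^sub>C x + b *\<^sub>C x" by (rule scaleC_add_left)
  show "a *\<^sub>C (b *\<^sub>C x) = (a * b) *\<^sub>C x" by (rule scaleC_scaleC)
  show "1 *\<^sub>C x = x" using scaleC_of_real[of 1 x] by simp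
qed

text \<open>
  The direct sum of copies of a Hilbert space over a finite type is the type of vectors of
  the library, whose norm is already the \<open>\<ell>\<^sup>2\<close> norm of the coordinate norms.
\<close>

instantiation vec :: (complex_hilbert_space, finite) complex_hilbert_space
begin

definition scaleC_vec :: "complex \<Rightarrow> 'a^'b \<Rightarrow> 'a^'b" where
  "scaleC_vec a v = (\<chi> i. a *\<^sub>C (v $ i))"

definition cinner_vec :: "'a^'b \<Rightarrow> 'a^'b \<Rightarrow> complex" where
  "cinner_vec v w = (\<Sum>i\<in>UNIV. cinner (v $ i) (w $ i))"

instance
proof
  fix a b :: complex and r :: real and x y z :: "'a^'b"
  show "a *\<^sub>C (x + y) = a *\<^sub>C x + a *\<^sub>C y"
    by (simp add: scaleC_vec_def vec_eq_iff scaleC_add_right)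
  show "(a + b) *\<^sub>C x = a *\<^sub>C x + b *\<^sub>C x"
    by (simp add: scaleC_vec_def vec_eq_iff scaleC_add_left)
  show "a *\<^sub>C (b *\<^sub>C x) = (a * b) *\<^sub>C x"
    by (simp add: scaleC_vec_def vec_eq_iff scaleC_scaleC)
  show "complex_of_real r *\<^sub>C x = r *\<^sub>R x"
    by (simp add: scaleC_vec_def vec_eq_iff scaleC_of_real)
  show "cinner x y = cnj (cinner y x)"
    unfolding cinner_vec_def cnj_sum by (rule sum.cong[OF refl]) (rule cinner_commute)
  show "cinner (x + y) z = cinner x z + cinner y z"
    by (simp add: cinner_vec_def cinner_add_left sum.distrib)
  show "cinner (a *\<^sub>C x) y = a * cinner x y"
    by (simp add: cinner_vec_def scaleC_vec_def cinner_scaleC_left sum_distrib_left)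
  show "cinner x x = complex_of_real ((norm x)\<^sup>2)"
    by (simp add: cinner_vec_def norm_vec_def L2_set_def cinner_self sum_nonneg)
qed

end

definition bounded_operators :: "('h::complex_hilbert_space \<Rightarrow> 'h) set" where
  "bounded_operators = {T. Vector_Spaces.linear (*\<^sub>C) (*\<^sub>C) T \<and> bounded_linear T}"

definition hilbert_isomorphism ::
    "('h::complex_hilbert_space \<Rightarrow> 'k::complex_hilbert_space) \<Rightarrow> bool" where
  "hilbert_isomorphism f \<longleftrightarrow>
     Vector_Spaces.linear (*\<^sub>C) (*\<^sub>C) f \<and> surj f \<and> (\<forall>\<xi>. norm (f \<xi>) = norm \<xi>)"


section \<open>Universal unital C*-algebras given by generators and relations\<close>

text \<open>
  The free unital *-algebra on a type of generators is the complex monoid algebra of the free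
  monoid of words in the generators and their formal adjoints. Words are wrapped in a datatype
  because the monoid algebra of the library expects an additively written monoid.
\<close>

datatype 's star_letter = Gen 's | Adj 's

datatype (word_gens: 's) star_word = Word (letters: "'s star_letter list")

instantiation star_word :: (type) monoid_add
begin

definition zero_star_word :: "'a star_word" where "0 = Word []"

definition plus_star_word :: "'a star_word \<Rightarrow> 'a star_word \<Rightarrow> 'a star_word" where
  "v + w = Word (letters v @ letters w)"

instance by standard (simp_all add: zero_star_word_def plus_star_word_def)

end

type_synonym 's star_poly = "'s star_word \<Rightarrow>\<^sub>0 complex"

primrec letter_star :: "'s star_letter \<Rightarrow> 's star_letter" where
  "letter_star (Gen s) = Adj s"
| "letter_star (Adj s) = Gen s"

definition word_star :: "'s star_word \<Rightarrow> 's star_word" where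
  "word_star w = Word (rev (map letter_star (letters w)))"

definition poly_star :: "'s star_poly \<Rightarrow> 's star_poly" where
  "poly_star p = (\<Sum>w\<in>Poly_Mapping.keys p.
     Poly_Mapping.single (word_star w) (cnj (Poly_Mapping.lookup p w)))"

definition poly_scale :: "complex \<Rightarrow> 's star_poly \<Rightarrow> 's star_poly" where
  "poly_scale c p = Poly_Mapping.map (\<lambda>z. c * z) p"

definition gen :: "'s \<Rightarrow> 's star_poly" where
  "gen s = Poly_Mapping.single (Word [Gen s]) 1"

definition free_star_algebra :: "'s set \<Rightarrow> 's star_poly set" where
  "free_star_algebra S = {p. \<forall>w\<in>Poly_Mapping.keys p. word_gens w \<subseteq> S}"

text \<open>
  Nonnegativity, \<open>p (poly_star a) = p a\<close> and \<open>p 1 \<in> {0, 1}\<close> follow from these conditions.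
\<close>

definition cstar_seminorm :: "'s set \<Rightarrow> ('s star_poly \<Rightarrow> real) \<Rightarrow> bool" where
  "cstar_seminorm S p \<longleftrightarrow>
     (\<forall>a\<in>free_star_algebra S. \<forall>b\<in>free_star_algebra S.
        p (a + b) \<le> p a + p b \<and> p (a * b) \<le> p a * p b) \<and>
     (\<forall>c. \<forall>a\<in>free_star_algebra S. p (poly_scale c a) = cmod c * p a) \<and>
     (\<forall>a\<in>free_star_algebra S. p (poly_star a * a) = (p a)\<^sup>2)"

text \<open>
  A set \<open>R\<close> of relators stands for the relations \<open>r = 0\<close>, \<open>r \<in> R\<close>. The universal C*-algebra is the
  Hausdorff completion of the free unital *-algebra in the largest C*-seminorm that vanishes on
  the relators (every such seminorm is the norm pulled back from a unital C*-algebra in which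
  the relations hold, and conversely). The supremum is meaningful when it is over a bounded
  set, which is the case whenever the relations bound the norm of each generator.
\<close>

definition universal_seminorm :: "'s set \<Rightarrow> 's star_poly set \<Rightarrow> 's star_poly \<Rightarrow> real" where
  "universal_seminorm S R a = (SUP p\<in>{p. cstar_seminorm S p \<and> (\<forall>r\<in>R. p r = 0)}. p a)"

definition cauchy_seqs :: "'s set \<Rightarrow> 's star_poly set \<Rightarrow> (nat \<Rightarrow> 's star_poly) set" where
  "cauchy_seqs S R = {s. (\<forall>n. s n \<in> free_star_algebra S) \<and>
     (\<forall>e>0. \<exists>N. \<forall>m\<ge>N. \<forall>n\<ge>N. universal_seminorm S R (s m - s n) < e)}"

definition null_rel :: "'s set \<Rightarrow> 's star_poly set \<Rightarrow>
    ((nat \<Rightarrow> 's star_poly) \<times> (nat \<Rightarrow> 's star_poly)) set" where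
  "null_rel S R = {(s, t). s \<in> cauchy_seqs S R \<and> t \<in> cauchy_seqs S R \<and>
     (\<lambda>n. universal_seminorm S R (s n - t n)) \<longlonglongrightarrow> 0}"

record 'a normed_star_algebra = "(complex, 'a) module" +
  alg_star :: "'a \<Rightarrow> 'a"
  alg_norm :: "'a \<Rightarrow> real"

definition universal_cstar_algebra ::
    "'s set \<Rightarrow> 's star_poly set \<Rightarrow> (nat \<Rightarrow> 's star_poly) set normed_star_algebra" where
  "universal_cstar_algebra S R =
     \<lparr>carrier = cauchy_seqs S R // null_rel S R,
      mult = (\<lambda>A B. \<Union>s\<in>A. \<Union>t\<in>B. null_rel S R `` {\<lambda>n. s n * t n}),
      one = null_rel S R `` {\<lambda>n. 1},
      ring.zero = null_rel S R `` {\<lambda>n. 0},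
      add = (\<lambda>A B. \<Union>s\<in>A. \<Union>t\<in>B. null_rel S R `` {\<lambda>n. s n + t n}),
      smult = (\<lambda>c A. \<Union>s\<in>A. null_rel S R `` {\<lambda>n. poly_scale c (s n)}),
      alg_star = (\<lambda>A. \<Union>s\<in>A. null_rel S R `` {\<lambda>n. poly_star (s n)}),
      alg_norm = (\<lambda>A. THE l. \<forall>s\<in>A. (\<lambda>n. universal_seminorm S R (s n)) \<longlonglongrightarrow> l)\<rparr>"

definition universal_gen ::
    "'s set \<Rightarrow> 's star_poly set \<Rightarrow> 's \<Rightarrow> (nat \<Rightarrow> 's star_poly) set" where
  "universal_gen S R s = null_rel S R `` {\<lambda>n. gen s}"

text \<open>Unital *-representations on a nonzero Hilbert space.\<close>

definition star_representation ::
    "('a, 'm) normed_star_algebra_scheme \<Rightarrow> ('a \<Rightarrow> 'h::complex_hilbert_space \<Rightarrow> 'h) \<Rightarrow> bool" where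
  "star_representation A \<Phi> \<longleftrightarrow>
     (\<exists>\<xi>::'h. \<xi> \<noteq> 0) \<and>
     (\<forall>a\<in>carrier A. \<Phi> a \<in> bounded_operators) \<and>
     (\<forall>a\<in>carrier A. \<forall>b\<in>carrier A. \<Phi> (a \<oplus>\<^bsub>A\<^esub> b) = (\<lambda>\<xi>. \<Phi> a \<xi> + \<Phi> b \<xi>)) \<and>
     (\<forall>c. \<forall>a\<in>carrier A. \<Phi> (c \<odot>\<^bsub>A\<^esub> a) = (\<lambda>\<xi>. c *\<^sub>C \<Phi> a \<xi>)) \<and>
     (\<forall>a\<in>carrier A. \<forall>b\<in>carrier A. \<Phi> (a \<otimes>\<^bsub>A\<^esub> b) = \<Phi> a \<circ> \<Phi> b) \<and>
     \<Phi> \<one>\<^bsub>A\<^esub> = id \<and>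
     (\<forall>a\<in>carrier A. \<forall>\<xi> \<eta>. cinner (\<Phi> (alg_star A a) \<xi>) \<eta> = cinner \<xi> (\<Phi> a \<eta>))"


section \<open>Self-similar groups\<close>

text \<open>
  The alphabet is a finite type and \<open>'x list\<close> is the rooted tree of words. Edges append a letter
  at the end of a word, whereas self-similarity splits off the first letter.
\<close>

definition tree_edge :: "'x list \<Rightarrow> 'x list \<Rightarrow> bool" where
  "tree_edge v w \<longleftrightarrow> (\<exists>x. w = v @ [x] \<or> v = w @ [x])"

definition rooted_tree_automorphism :: "('x list \<Rightarrow> 'x list) \<Rightarrow> bool" where
  "rooted_tree_automorphism f \<longleftrightarrow>
     bij f \<and> f [] = [] \<and> (\<forall>v w. tree_edge (f v) (f w) \<longleftrightarrow> tree_edge v w)"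

text \<open>The relation \<open>g (x w) = y (h w)\<close> for all words \<open>w\<close>, that is, \<open>y = g x\<close> and \<open>h\<close> is the section
  of \<open>g\<close> at \<open>x\<close>.\<close>

definition wreath_relation ::
    "('g \<Rightarrow> 'x list \<Rightarrow> 'x list) \<Rightarrow> 'g \<Rightarrow> 'x \<Rightarrow> 'x \<Rightarrow> 'g \<Rightarrow> bool" where
  "wreath_relation act g x y h \<longleftrightarrow> (\<forall>w. act g (x # w) = y # act h w)"

definition self_similar_group ::
    "('g, 'm) monoid_scheme \<Rightarrow> ('g \<Rightarrow> 'x::finite list \<Rightarrow> 'x list) \<Rightarrow> bool" where
  "self_similar_group G act \<longleftrightarrow>
     faithful_action G UNIV act \<and>
     (\<forall>g\<in>carrier G. rooted_tree_automorphism (act g)) \<and>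
     (\<forall>g\<in>carrier G. \<forall>x. \<exists>h\<in>carrier G. \<exists>y. wreath_relation act g x y h)"


section \<open>Similarities, the Cuntz algebra and the Cuntz-Pimsner algebra\<close>

definition similarity :: "('h::complex_hilbert_space \<Rightarrow> 'h^'x::finite) \<Rightarrow> bool" where
  "similarity \<psi> \<longleftrightarrow>
     (\<nexists>B::'h set. finite B \<and> complex_vector.span B = UNIV) \<and> hilbert_isomorphism \<psi>"

text \<open>The isometry associated with \<open>\<psi>\<close> and \<open>x\<close>; \<open>axis x \<xi>\<close> has \<open>\<xi>\<close> in coordinate \<open>x\<close>.\<close>

definition isometry_of :: "('h::complex_hilbert_space \<Rightarrow> 'h^'x::finite) \<Rightarrow> 'x \<Rightarrow> 'h \<Rightarrow> 'h" where
  "isometry_of \<psi> x \<xi> = inv_into UNIV \<psi> (axis x \<xi>)"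

text \<open>The parameter \<open>a\<close> names the generators that play the role of the isometries.\<close>

definition cuntz_relators :: "('x::finite \<Rightarrow> 's) \<Rightarrow> 's star_poly set" where
  "cuntz_relators a =
     {poly_star (gen (a x)) * gen (a x) - 1 | x. True} \<union>
     {(\<Sum>x\<in>UNIV. gen (a x) * poly_star (gen (a x))) - 1}"

definition cuntz_algebra :: "(nat \<Rightarrow> 'x::finite star_poly) set normed_star_algebra" where
  "cuntz_algebra = universal_cstar_algebra UNIV (cuntz_relators id)"

definition cuntz_gen :: "'x::finite \<Rightarrow> (nat \<Rightarrow> 'x star_poly) set" where
  "cuntz_gen = universal_gen UNIV (cuntz_relators id)"

text \<open>The representation is determined only on the carrier of the Cuntz algebra; there it is
  unique, because the algebra is generated by the elements \<open>cuntz_gen x\<close>.\<close>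

definition cuntz_representation :: "('h::complex_hilbert_space \<Rightarrow> 'h^'x::finite) \<Rightarrow>
    (nat \<Rightarrow> 'x star_poly) set \<Rightarrow> 'h \<Rightarrow> 'h" where
  "cuntz_representation \<psi> =
     (SOME \<pi>. star_representation cuntz_algebra \<pi> \<and> (\<forall>x. \<pi> (cuntz_gen x) = isometry_of \<psi> x))"

definition group_relators :: "('g, 'm) monoid_scheme \<Rightarrow> ('g \<Rightarrow> 's) \<Rightarrow> 's star_poly set" where
  "group_relators G u =
     {gen (u g) * gen (u h) - gen (u (g \<otimes>\<^bsub>G\<^esub> h)) | g h. g \<in> carrier G \<and> h \<in> carrier G} \<union>
     {gen (u \<one>\<^bsub>G\<^esub>) - 1} \<union>
     {poly_star (gen (u g)) * gen (u g) - 1 | g. g \<in> carrier G} \<union>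
     {gen (u g) * poly_star (gen (u g)) - 1 | g. g \<in> carrier G}"

definition cuntz_pimsner_gens :: "('g, 'm) monoid_scheme \<Rightarrow> ('g + 'x) set" where
  "cuntz_pimsner_gens G = Inl ` carrier G \<union> range Inr"

definition cuntz_pimsner_relators :: "('g, 'm) monoid_scheme \<Rightarrow>
    ('g \<Rightarrow> 'x::finite list \<Rightarrow> 'x list) \<Rightarrow> ('g + 'x) star_poly set" where
  "cuntz_pimsner_relators G act =
     group_relators G Inl \<union> cuntz_relators Inr \<union>
     {gen (Inl g) * gen (Inr x) - gen (Inr y) * gen (Inl h) | g x y h.
        g \<in> carrier G \<and> h \<in> carrier G \<and> wreath_relation act g x y h}"

definition cuntz_pimsner_algebra :: "('g, 'm) monoid_scheme \<Rightarrow>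
    ('g \<Rightarrow> 'x::finite list \<Rightarrow> 'x list) \<Rightarrow> (nat \<Rightarrow> ('g + 'x) star_poly) set normed_star_algebra" where
  "cuntz_pimsner_algebra G act =
     universal_cstar_algebra (cuntz_pimsner_gens G) (cuntz_pimsner_relators G act)"

definition cuntz_pimsner_unitary :: "('g, 'm) monoid_scheme \<Rightarrow>
    ('g \<Rightarrow> 'x::finite list \<Rightarrow> 'x list) \<Rightarrow> 'g \<Rightarrow> (nat \<Rightarrow> ('g + 'x) star_poly) set" where
  "cuntz_pimsner_unitary G act g =
     universal_gen (cuntz_pimsner_gens G) (cuntz_pimsner_relators G act) (Inl g)"

definition cuntz_pimsner_isometry :: "('g, 'm) monoid_scheme \<Rightarrow>
    ('g \<Rightarrow> 'x::finite list \<Rightarrow> 'x list) \<Rightarrow> 'x \<Rightarrow> (nat \<Rightarrow> ('g + 'x) star_poly) set" where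
  "cuntz_pimsner_isometry G act x =
     universal_gen (cuntz_pimsner_gens G) (cuntz_pimsner_relators G act) (Inr x)"


section \<open>Self-similar representations\<close>

definition unitary_representation ::
    "('g, 'm) monoid_scheme \<Rightarrow> ('g \<Rightarrow> 'h::complex_hilbert_space \<Rightarrow> 'h) \<Rightarrow> bool" where
  "unitary_representation G \<rho> \<longleftrightarrow>
     (\<forall>g\<in>carrier G. hilbert_isomorphism (\<rho> g)) \<and>
     (\<forall>g\<in>carrier G. \<forall>h\<in>carrier G. \<rho> (g \<otimes>\<^bsub>G\<^esub> h) = \<rho> g \<circ> \<rho> h)"

definition self_similar_wrt :: "('g, 'm) monoid_scheme \<Rightarrow>
    ('g \<Rightarrow> 'x::finite list \<Rightarrow> 'x list) \<Rightarrow> ('h::complex_hilbert_space \<Rightarrow> 'h^'x) \<Rightarrow>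
    ('g \<Rightarrow> 'h \<Rightarrow> 'h) \<Rightarrow> bool" where
  "self_similar_wrt G act \<psi> \<rho> \<longleftrightarrow>
     (\<forall>g\<in>carrier G. \<forall>h\<in>carrier G. \<forall>x y. wreath_relation act g x y h \<longrightarrow>
        \<rho> g \<circ> isometry_of \<psi> x = isometry_of \<psi> y \<circ> \<rho> h)"

definition self_similar_representation :: "('g, 'm) monoid_scheme \<Rightarrow>
    ('g \<Rightarrow> 'x::finite list \<Rightarrow> 'x list) \<Rightarrow> ('g \<Rightarrow> 'h::complex_hilbert_space \<Rightarrow> 'h) \<Rightarrow> bool" where
  "self_similar_representation G act \<rho> \<longleftrightarrow>
     unitary_representation G \<rho> \<and>
     (\<exists>\<psi>::'h \<Rightarrow> 'h^'x. similarity \<psi> \<and> self_similar_wrt G act \<psi> \<rho>)"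

end

theory Submission
  imports Defs
begin

text \<open>
  A universal algebra has a representation with prescribed values on the generators as soon as
  these values are operators with adjoints that satisfy the relations: the operator norm of an
  evaluated *-polynomial is then a C*-seminorm that vanishes on the relators, so it is at most
  the universal seminorm, and evaluation passes to limits of Cauchy sequences. Applied to
  \<open>O\<^sub>d\<close> this identifies \<open>\<pi>(a\<^sub>x)\<close> with \<open>T\<^sub>x\<close>; applied to \<open>O\<^sub>G\<close> it shows that self-similarity of
  \<open>\<rho>\<close>, which is the only relation of \<open>O\<^sub>G\<close> not already guaranteed by \<open>\<rho>\<close> and \<open>\<pi>\<close>, suffices.
  Conversely, a representation of \<open>O\<^sub>G\<close> maps the \<open>a\<^sub>x\<close> to isometries \<open>T\<^sub>x\<close> with \<open>\<Sum>\<^sub>x T\<^sub>x T\<^sub>x\<^sup>* = 1\<close>,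
  and \<open>\<xi> \<mapsto> (T\<^sub>x\<^sup>* \<xi>)\<^sub>x\<close> is a similarity that gives back the \<open>T\<^sub>x\<close>. Its space is infinite-dimensional
  because injective linear maps of a finite-dimensional space are onto, whereas two of the \<open>T\<^sub>x\<close>
  have orthogonal ranges.
\<close>

section \<open>The free unital *-algebra\<close>

lemma poly_mapping_expand: "p = (\<Sum>w\<in>Poly_Mapping.keys p. Poly_Mapping.single w (Poly_Mapping.lookup p w))"
proof (rule poly_mapping_eqI)
  fix k
  show "Poly_Mapping.lookup p k
      = Poly_Mapping.lookup (\<Sum>w\<in>Poly_Mapping.keys p. Poly_Mapping.single w (Poly_Mapping.lookup p w)) k"
    by (auto simp: lookup_sum lookup_single when_def sum.delta in_keys_iff)
qed

lemma letter_star_letter_star [simp]: "letter_star (letter_star l) = l"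
  by (cases l) auto

lemma word_star_word_star [simp]: "word_star (word_star w) = w"
  by (simp add: word_star_def rev_map comp_def)

lemma word_star_eq_iff: "word_star v = w \<longleftrightarrow> v = word_star w"
  by auto

lemma word_gens_word_star [simp]: "word_gens (word_star w) = word_gens w"
proof -
  have "set_star_letter (letter_star l) = set_star_letter l" for l :: "'a star_letter"
    by (cases l) auto
  then show ?thesis by (cases w) (auto simp: word_star_def)
qed

lemma word_gens_plus [simp]: "word_gens (v + w) = word_gens v \<union> word_gens w"
  by (cases v; cases w) (simp add: plus_star_word_def)

lemma word_gens_zero [simp]: "word_gens 0 = {}"
  by (simp add: zero_star_word_def)

text \<open>Because \<open>word_star\<close> is an involution, at most one key contributes to a
  given coefficient. In this coefficientwise form the laws of the star become immediate.\<close>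

lemma lookup_poly_star: "Poly_Mapping.lookup (poly_star p) w = cnj (Poly_Mapping.lookup p (word_star w))"
proof -
  have "Poly_Mapping.lookup (poly_star p) w
      = (\<Sum>v\<in>Poly_Mapping.keys p. if v = word_star w then cnj (Poly_Mapping.lookup p v) else 0)"
    unfolding poly_star_def lookup_sum
    by (rule sum.cong) (auto simp: lookup_single when_def word_star_eq_iff)
  also have "\<dots> = cnj (Poly_Mapping.lookup p (word_star w))"
    by (auto simp: sum.delta in_keys_iff)
  finally show ?thesis .
qed

lemma poly_star_poly_star [simp]: "poly_star (poly_star p) = p"
  by (rule poly_mapping_eqI) (simp add: lookup_poly_star)

lemma poly_star_diff: "poly_star (p - q) = poly_star p - poly_star q"
  by (rule poly_mapping_eqI) (simp add: lookup_poly_star lookup_minus)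

lemma poly_star_single [simp]:
  "poly_star (Poly_Mapping.single w c) = Poly_Mapping.single (word_star w) (cnj c)"
  by (rule poly_mapping_eqI) (auto simp: lookup_poly_star lookup_single when_def)

text \<open>Viewing a scalar as a multiple of the empty word turns facts about scaling into facts
  about ring multiplication.\<close>

lemma poly_scale_eq_mult: "poly_scale c p = Poly_Mapping.single 0 c * p"
  unfolding poly_scale_def by (rule mult_map_scale_conv_mult)

lemma poly_scale_diff: "poly_scale c (p - q) = poly_scale c p - poly_scale c q"
  by (simp add: poly_scale_eq_mult right_diff_distrib)

lemma poly_scale_zero [simp]: "poly_scale 0 p = 0"
  by (simp add: poly_scale_eq_mult)

lemma poly_scale_minus_one [simp]: "poly_scale (- 1) p = - p"
  by (simp add: poly_scale_eq_mult single_uminus)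

lemma word_star_zero [simp]: "word_star 0 = 0"
  by (simp add: word_star_def zero_star_word_def)

lemma poly_star_one [simp]: "poly_star 1 = 1"
  using poly_star_single[of 0 1] by simp

lemma free_star_algebra_iff:
  "p \<in> free_star_algebra S \<longleftrightarrow> (\<forall>w. Poly_Mapping.lookup p w \<noteq> 0 \<longrightarrow> word_gens w \<subseteq> S)"
  by (auto simp: free_star_algebra_def in_keys_iff)

context
  fixes S :: "'s set"
begin

lemma single_free [simp, intro]: "word_gens w \<subseteq> S \<Longrightarrow> Poly_Mapping.single w c \<in> free_star_algebra S"
  by (auto simp: free_star_algebra_iff lookup_single when_def)

lemma gen_free [simp, intro]: "s \<in> S \<Longrightarrow> gen s \<in> free_star_algebra S"
  by (auto simp: gen_def)

lemma zero_free [simp, intro]: "0 \<in> free_star_algebra S"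
  by (auto simp: free_star_algebra_iff)

lemma one_free [simp, intro]: "1 \<in> free_star_algebra S"
  using single_free[of 0 1] by simp

lemma add_free [simp, intro]:
  "p \<in> free_star_algebra S \<Longrightarrow> q \<in> free_star_algebra S \<Longrightarrow> p + q \<in> free_star_algebra S"
  by (auto simp: free_star_algebra_iff lookup_add) (metis add_0_right subsetD)

lemma minus_free [simp, intro]:
  "p \<in> free_star_algebra S \<Longrightarrow> - p \<in> free_star_algebra S"
  by (auto simp: free_star_algebra_iff)

lemma diff_free [simp, intro]:
  "p \<in> free_star_algebra S \<Longrightarrow> q \<in> free_star_algebra S \<Longrightarrow> p - q \<in> free_star_algebra S"
  using add_free[of p "- q"] by simp

lemma mult_free [simp, intro]:
  assumes "p \<in> free_star_algebra S" "q \<in> free_star_algebra S"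
  shows "p * q \<in> free_star_algebra S"
  unfolding free_star_algebra_def
proof (intro CollectI ballI)
  fix w assume "w \<in> Poly_Mapping.keys (p * q)"
  then obtain a b where "w = a + b" "a \<in> Poly_Mapping.keys p" "b \<in> Poly_Mapping.keys q"
    using keys_mult[of p q] by blast
  then show "word_gens w \<subseteq> S" using assms by (auto simp: free_star_algebra_def)
qed

lemma poly_star_free [simp, intro]: "p \<in> free_star_algebra S \<Longrightarrow> poly_star p \<in> free_star_algebra S"
  by (metis complex_cnj_zero free_star_algebra_iff lookup_poly_star word_gens_word_star)

lemma poly_scale_free [simp, intro]: "p \<in> free_star_algebra S \<Longrightarrow> poly_scale c p \<in> free_star_algebra S"
  by (simp add: poly_scale_eq_mult)

lemma sum_free [simp, intro]:
  "(\<And>i. i \<in> A \<Longrightarrow> f i \<in> free_star_algebra S) \<Longrightarrow> sum f A \<in> free_star_algebra S"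
  by (induction A rule: infinite_finite_induct) auto

lemma keys_free: "p \<in> free_star_algebra S \<Longrightarrow> w \<in> Poly_Mapping.keys p \<Longrightarrow> word_gens w \<subseteq> S"
  by (auto simp: free_star_algebra_def)

end

section \<open>The universal seminorm\<close>

context
  fixes S :: "'s set" and p :: "'s star_poly \<Rightarrow> real"
  assumes p: "cstar_seminorm S p"
begin

lemma seminorm_add: "a \<in> free_star_algebra S \<Longrightarrow> b \<in> free_star_algebra S \<Longrightarrow> p (a + b) \<le> p a + p b"
  and seminorm_mult: "a \<in> free_star_algebra S \<Longrightarrow> b \<in> free_star_algebra S \<Longrightarrow> p (a * b) \<le> p a * p b"
  and seminorm_scale: "a \<in> free_star_algebra S \<Longrightarrow> p (poly_scale c a) = cmod c * p a"
  and seminorm_cstar: "a \<in> free_star_algebra S \<Longrightarrow> p (poly_star a * a) = (p a)\<^sup>2"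
  using p unfolding cstar_seminorm_def by blast+

lemma seminorm_zero: "p 0 = 0"
  using seminorm_scale[of 0 0] by simp

lemma seminorm_minus: "a \<in> free_star_algebra S \<Longrightarrow> p (- a) = p a"
  using seminorm_scale[of a "- 1"] by simp

lemma seminorm_nonneg: "a \<in> free_star_algebra S \<Longrightarrow> 0 \<le> p a"
  using seminorm_add[of a "- a"] by (simp add: seminorm_minus seminorm_zero)

text \<open>The C*-identity and submultiplicativity give
  \<open>(p a)\<^sup>2 \<le> p (poly_star a) * p a\<close>, where a nonzero factor
  \<open>p a\<close> cancels. Applied to the adjoint as well, this makes the star isometric.\<close>

lemma seminorm_le_star:
  assumes "a \<in> free_star_algebra S"
  shows "p a \<le> p (poly_star a)"
proof (cases "p a = 0")
  case False
  have "p a * p a \<le> p (poly_star a) * p a"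
    using seminorm_cstar[OF assms] seminorm_mult[of "poly_star a" a] assms
    by (simp add: power2_eq_square)
  then show ?thesis using False seminorm_nonneg[OF assms] by simp
qed (use assms in \<open>simp add: seminorm_nonneg\<close>)

lemma seminorm_star: "a \<in> free_star_algebra S \<Longrightarrow> p (poly_star a) = p a"
  using seminorm_le_star[of a] seminorm_le_star[of "poly_star a"] by simp

text \<open>The unit is its own adjoint, so the C*-identity makes \<open>p 1\<close> equal to its
  square.\<close>

lemma seminorm_one_le: "p 1 \<le> 1"
proof (rule ccontr)
  assume "\<not> p 1 \<le> 1"
  then have "p 1 * 1 < p 1 * p 1" by (intro mult_strict_left_mono) auto
  then show False using seminorm_cstar[of 1] by (auto simp: power2_eq_square)
qed

text \<open>The C*-identity turns a bound on \<open>poly_star a * a\<close>, which differs from 1 by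
  an element of seminorm zero, into a bound on \<open>a\<close>. This is the source of the uniform
  bounds on generators.\<close>

lemma seminorm_isometry_le:
  assumes "a \<in> free_star_algebra S" "p (poly_star a * a - 1) = 0"
  shows "p a \<le> 1"
proof -
  have "(p a)\<^sup>2 = p ((poly_star a * a - 1) + 1)"
    using seminorm_cstar[OF assms(1)] by simp
  also have "\<dots> \<le> 1"
    using seminorm_add[of "poly_star a * a - 1" 1] seminorm_one_le assms by simp
  finally show ?thesis using seminorm_nonneg[OF assms(1)] by (simp add: power_le_one_iff abs_square_le_1)
qed

end

lemma cstar_seminorm_zero: "cstar_seminorm S (\<lambda>_. 0)"
  by (simp add: cstar_seminorm_def)

text \<open>A bound on each generator that is uniform in the seminorm makes every supremum finite:
  monomials follow by submultiplicativity, and all other elements are finite sums of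
  monomials.\<close>

locale bounded_relations =
  fixes S :: "'s set" and R :: "'s star_poly set"
  assumes gen_bounded:
    "s \<in> S \<Longrightarrow> \<exists>c. \<forall>p. cstar_seminorm S p \<longrightarrow> (\<forall>r\<in>R. p r = 0) \<longrightarrow> p (gen s) \<le> c"
begin

abbreviation F :: "'s star_poly set" where "F \<equiv> free_star_algebra S"

abbreviation U :: "'s star_poly \<Rightarrow> real" where "U \<equiv> universal_seminorm S R"

definition admissible :: "('s star_poly \<Rightarrow> real) set" where
  "admissible = {p. cstar_seminorm S p \<and> (\<forall>r\<in>R. p r = 0)}"

text \<open>Keeps the supremum over a nonempty set, as the \<open>SUP\<close> of reals needs; it
  also gives nonnegativity of \<open>U\<close>.\<close>

lemma zero_admissible: "(\<lambda>_. 0) \<in> admissible"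
  by (simp add: admissible_def cstar_seminorm_zero)

lemma admissible_seminorm: "p \<in> admissible \<Longrightarrow> cstar_seminorm S p"
  by (simp add: admissible_def)

lemma bdd_mult:
  assumes "a \<in> F" "b \<in> F" "bdd_above ((\<lambda>p. p a) ` admissible)" "bdd_above ((\<lambda>p. p b) ` admissible)"
  shows "bdd_above ((\<lambda>p. p (a * b)) ` admissible)"
proof -
  from assms(3,4) obtain c d where cd: "\<And>p. p \<in> admissible \<Longrightarrow> p a \<le> c" "\<And>p. p \<in> admissible \<Longrightarrow> p b \<le> d"
    by (auto simp: bdd_above_def)
  have "p (a * b) \<le> c * d" if "p \<in> admissible" for p
  proof -
    note p = admissible_seminorm[OF that]
    have "p (a * b) \<le> p a * p b" by (rule seminorm_mult[OF p assms(1,2)])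
    also have "\<dots> \<le> c * d"
      using cd[OF that] seminorm_nonneg[OF p assms(1)] seminorm_nonneg[OF p assms(2)]
      by (intro mult_mono) auto
    finally show ?thesis .
  qed
  then show ?thesis by (auto simp: bdd_above_def)
qed

lemma bdd_single_one:
  "word_gens (Word ls) \<subseteq> S \<Longrightarrow> bdd_above ((\<lambda>p. p (Poly_Mapping.single (Word ls) 1)) ` admissible)"
proof (induction ls)
  case Nil
  have "Poly_Mapping.single (Word []) 1 = (1 :: 's star_poly)"
    by (metis single_one zero_star_word_def)
  then show ?case
    using seminorm_one_le admissible_seminorm by (auto simp: bdd_above_def)
next
  case (Cons l ls)
  have bdd_gen: "bdd_above ((\<lambda>p. p (gen s)) ` admissible)" if "s \<in> S" for s
    using gen_bounded[OF that] by (auto simp: admissible_def bdd_above_def)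
  have "bdd_above ((\<lambda>p. p (Poly_Mapping.single (Word [l]) 1)) ` admissible)"
  proof (cases l)
    case (Gen s)
    then show ?thesis using Cons.prems bdd_gen[of s] by (simp add: gen_def)
  next
    case (Adj s)
    then have s: "s \<in> S" using Cons.prems by simp
    \<comment> \<open>An adjoint letter has the same seminorm as its generator and inherits the
      bound.\<close>
    have "p (Poly_Mapping.single (Word [Adj s]) 1) = p (gen s)" if "p \<in> admissible" for p
      using seminorm_star[OF admissible_seminorm[OF that] gen_free[OF s]]
      by (simp add: gen_def word_star_def)
    then have "(\<lambda>p. p (Poly_Mapping.single (Word [l]) 1)) ` admissible = (\<lambda>p. p (gen s)) ` admissible"
      unfolding Adj by (intro image_cong refl)
    then show ?thesis using bdd_gen[OF s] by simp
  qed
  moreover have "Poly_Mapping.single (Word (l # ls)) 1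
      = Poly_Mapping.single (Word [l]) 1 * Poly_Mapping.single (Word ls) (1 :: complex)"
    by (simp add: mult_single plus_star_word_def)
  ultimately show ?case
    using Cons bdd_mult[of "Poly_Mapping.single (Word [l]) 1" "Poly_Mapping.single (Word ls) 1"]
    by simp
qed

lemma bdd_single:
  assumes "word_gens w \<subseteq> S"
  shows "bdd_above ((\<lambda>p. p (Poly_Mapping.single w c)) ` admissible)"
proof -
  have eq: "Poly_Mapping.single w c = poly_scale c (Poly_Mapping.single w 1)"
    by (simp add: poly_scale_eq_mult mult_single)
  from bdd_single_one[of "letters w"] assms obtain d
    where "\<And>p. p \<in> admissible \<Longrightarrow> p (Poly_Mapping.single w 1) \<le> d"
    by (auto simp: bdd_above_def)
  then have "p (Poly_Mapping.single w c) \<le> cmod c * d" if "p \<in> admissible" for p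
    using that seminorm_scale[OF admissible_seminorm[OF that] single_free[OF assms]]
    by (simp add: eq mult_left_mono)
  then show ?thesis by (auto simp: bdd_above_def)
qed

lemma bdd_sum:
  "\<lbrakk>\<And>i. i \<in> A \<Longrightarrow> f i \<in> F; \<And>i. i \<in> A \<Longrightarrow> bdd_above ((\<lambda>p. p (f i)) ` admissible)\<rbrakk>
    \<Longrightarrow> bdd_above ((\<lambda>p. p (sum f A)) ` admissible)"
proof (induction A rule: infinite_finite_induct)
  case (insert i A)
  then have "bdd_above ((\<lambda>p. p (f i)) ` admissible)" "bdd_above ((\<lambda>p. p (sum f A)) ` admissible)"
    by auto
  then obtain c d where
    "\<And>p. p \<in> admissible \<Longrightarrow> p (f i) \<le> c" "\<And>p. p \<in> admissible \<Longrightarrow> p (sum f A) \<le> d"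
    unfolding bdd_above_def by blast
  moreover have "p (f i + sum f A) \<le> p (f i) + p (sum f A)" if "p \<in> admissible" for p
    using insert.prems by (intro seminorm_add[OF admissible_seminorm[OF that]]) auto
  ultimately have "p (sum f (insert i A)) \<le> c + d" if "p \<in> admissible" for p
    using that insert.hyps by (simp, smt (verit))
  then show ?case by (auto simp: bdd_above_def)
qed (auto simp: bdd_above_def seminorm_zero[OF admissible_seminorm])

lemma bdd_admissible:
  assumes "a \<in> F"
  shows "bdd_above ((\<lambda>p. p a) ` admissible)"
proof -
  have "bdd_above ((\<lambda>p. p (\<Sum>w\<in>Poly_Mapping.keys a.
      Poly_Mapping.single w (Poly_Mapping.lookup a w))) ` admissible)"
    using keys_free[OF assms] by (intro bdd_sum bdd_single) auto
  then show ?thesis by (subst poly_mapping_expand[of a])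
qed

text \<open>Finiteness of the supremum is used here. Together with \<open>U_least\<close>, this
  transfers inequalities from the individual seminorms to \<open>U\<close>.\<close>

lemma U_upper: "p \<in> admissible \<Longrightarrow> a \<in> F \<Longrightarrow> p a \<le> U a"
  unfolding universal_seminorm_def admissible_def[symmetric]
  by (rule cSUP_upper[OF _ bdd_admissible])

lemma U_least: "(\<And>p. p \<in> admissible \<Longrightarrow> p a \<le> c) \<Longrightarrow> U a \<le> c"
  unfolding universal_seminorm_def admissible_def[symmetric]
  using zero_admissible by (intro cSUP_least) auto

lemma U_nonneg: "a \<in> F \<Longrightarrow> 0 \<le> U a"
  using U_upper[OF zero_admissible] .

lemma U_le_zero_eq: "a \<in> F \<Longrightarrow> (\<And>p. p \<in> admissible \<Longrightarrow> p a \<le> 0) \<Longrightarrow> U a = 0"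
  by (intro antisym U_least U_nonneg)

lemma U_zero: "U 0 = 0"
  by (intro U_le_zero_eq) (auto simp: seminorm_zero[OF admissible_seminorm])

lemma U_relator: "r \<in> R \<Longrightarrow> r \<in> F \<Longrightarrow> U r = 0"
  by (intro U_le_zero_eq) (auto simp: admissible_def)

lemma U_add:
  assumes "a \<in> F" "b \<in> F"
  shows "U (a + b) \<le> U a + U b"
proof (rule U_least)
  fix p assume p: "p \<in> admissible"
  show "p (a + b) \<le> U a + U b"
    using seminorm_add[OF admissible_seminorm[OF p] assms] U_upper[OF p] assms
    by (smt (verit))
qed

lemma U_mult:
  assumes "a \<in> F" "b \<in> F"
  shows "U (a * b) \<le> U a * U b"
proof (rule U_least)
  fix p assume p: "p \<in> admissible"
  have "p (a * b) \<le> p a * p b"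
    by (rule seminorm_mult[OF admissible_seminorm[OF p] assms])
  also have "\<dots> \<le> U a * U b"
    using U_upper[OF p] U_nonneg seminorm_nonneg[OF admissible_seminorm[OF p]] assms
    by (intro mult_mono) auto
  finally show "p (a * b) \<le> U a * U b" .
qed

lemma U_scale:
  assumes "a \<in> F"
  shows "U (poly_scale c a) \<le> cmod c * U a"
proof (rule U_least)
  fix p assume p: "p \<in> admissible"
  show "p (poly_scale c a) \<le> cmod c * U a"
    using U_upper[OF p assms] seminorm_scale[OF admissible_seminorm[OF p] assms]
    by (simp add: mult_left_mono)
qed

lemma U_star:
  assumes "a \<in> F"
  shows "U (poly_star a) \<le> U a"
proof (rule U_least)
  fix p assume p: "p \<in> admissible"
  show "p (poly_star a) \<le> U a"
    using U_upper[OF p assms] seminorm_star[OF admissible_seminorm[OF p] assms] by simp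
qed

lemma U_minus: "a \<in> F \<Longrightarrow> U (- a) \<le> U a"
  using U_scale[of a "- 1"] by simp

lemma U_diff_commute: "a \<in> F \<Longrightarrow> b \<in> F \<Longrightarrow> U (a - b) = U (b - a)"
  using U_minus[of "a - b"] U_minus[of "b - a"] by simp

lemma U_triangle: "a \<in> F \<Longrightarrow> b \<in> F \<Longrightarrow> c \<in> F \<Longrightarrow> U (a - c) \<le> U (a - b) + U (b - c)"
  using U_add[of "a - b" "b - c"] by simp

lemma U_add_diff:
  assumes "a \<in> F" "b \<in> F" "c \<in> F" "d \<in> F"
  shows "U ((a + b) - (c + d)) \<le> U (a - c) + U (b - d)"
  using U_add[of "a - c" "b - d"] assms by (simp add: algebra_simps)

text \<open>The difference is telescoped through \<open>c * b\<close>. The remaining factors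
  \<open>U b\<close> and \<open>U c\<close> are why the Lipschitz constant of multiplication depends
  on a bound of the arguments.\<close>

lemma U_mult_diff:
  assumes "a \<in> F" "b \<in> F" "c \<in> F" "d \<in> F"
  shows "U (a * b - c * d) \<le> U (a - c) * U b + U c * U (b - d)"
proof -
  have "a * b - c * d = (a - c) * b + c * (b - d)" by (simp add: algebra_simps)
  then have "U (a * b - c * d) \<le> U ((a - c) * b) + U (c * (b - d))"
    using U_add[of "(a - c) * b" "c * (b - d)"] assms by simp
  also have "\<dots> \<le> U (a - c) * U b + U c * U (b - d)"
    using assms by (intro add_mono U_mult) auto
  finally show ?thesis .
qed

end

section \<open>The operations of the universal C*-algebra\<close>

context bounded_relations
begin

abbreviation C :: "(nat \<Rightarrow> 's star_poly) set" where "C \<equiv> cauchy_seqs S R"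

abbreviation A :: "(nat \<Rightarrow> 's star_poly) set normed_star_algebra" where
  "A \<equiv> universal_cstar_algebra S R"

definition cls :: "(nat \<Rightarrow> 's star_poly) \<Rightarrow> (nat \<Rightarrow> 's star_poly) set" where
  "cls s = null_rel S R `` {s}"

section \<open>Cauchy sequences and null sequences\<close>

lemma cauchy_free: "s \<in> C \<Longrightarrow> s n \<in> F"
  by (simp add: cauchy_seqs_def)

lemma cauchyD: "s \<in> C \<Longrightarrow> e > 0 \<Longrightarrow> \<exists>N. \<forall>m\<ge>N. \<forall>n\<ge>N. U (s m - s n) < e"
  by (simp add: cauchy_seqs_def)

lemma const_cauchy: "a \<in> F \<Longrightarrow> (\<lambda>_. a) \<in> C"
  by (simp add: cauchy_seqs_def U_zero)

lemma cauchy_bounded: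
  assumes s: "s \<in> C"
  obtains M where "M \<ge> 0" "\<And>n. U (s n) \<le> M"
proof -
  obtain N where N: "\<forall>m\<ge>N. \<forall>n\<ge>N. U (s m - s n) < 1"
    using cauchyD[OF s, of 1] by auto
  let ?M = "(\<Sum>k\<le>N. U (s k)) + 1"
  note nonneg = U_nonneg[OF cauchy_free[OF s]]
  have le_sum: "U (s k) \<le> (\<Sum>k\<le>N. U (s k))" if "k \<le> N" for k
    using that nonneg by (intro member_le_sum) auto
  have "U (s n) \<le> ?M" for n
  proof (cases "n \<le> N")
    case False
    then have "U (s n - s N) < 1" using N by auto
    then show ?thesis
      using U_add[of "s n - s N" "s N"] cauchy_free[OF s] le_sum[of N] by simp
  qed (use le_sum[of n] in simp)
  moreover have "?M \<ge> 0" using nonneg by (simp add: sum_nonneg add_nonneg_nonneg)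
  ultimately show ?thesis using that by blast
qed

text \<open>One criterion for all operations: a sequence is Cauchy when its increments are
  controlled by those of two Cauchy sequences. Unary operations take \<open>t = s\<close> and
  \<open>b = 0\<close>.\<close>

lemma cauchy_dominated:
  assumes s: "s \<in> C" and t: "t \<in> C" and r: "\<And>n. r n \<in> F" and ab: "a \<ge> 0" "b \<ge> 0"
    and le: "\<And>m n. U (r m - r n) \<le> a * U (s m - s n) + b * U (t m - t n)"
  shows "r \<in> C"
  unfolding cauchy_seqs_def
proof (intro CollectI conjI allI impI r)
  fix e :: real assume e: "e > 0"
  \<comment> \<open>The extra 1 keeps the denominator positive and leaves the slack
    \<open>a * e' + b * e' = e - e'\<close>, which makes the final inequality strict.\<close>
  define e' where "e' = e / (a + b + 1)"
  have "(a + b + 1) * e' = e" "e' > 0"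
    using e ab by (simp_all add: e'_def)
  then have e': "e' > 0" "a * e' + b * e' < e"
    by (simp_all add: algebra_simps)
  obtain N1 where N1: "\<forall>m\<ge>N1. \<forall>n\<ge>N1. U (s m - s n) < e'"
    using cauchyD[OF s e'(1)] by blast
  obtain N2 where N2: "\<forall>m\<ge>N2. \<forall>n\<ge>N2. U (t m - t n) < e'"
    using cauchyD[OF t e'(1)] by blast
  have "U (r m - r n) < e" if "m \<ge> max N1 N2" "n \<ge> max N1 N2" for m n
  proof -
    have "U (r m - r n) \<le> a * e' + b * e'"
      using N1 N2 that ab
      by (intro order.trans[OF le] add_mono mult_left_mono) (auto intro: less_imp_le)
    then show ?thesis using e'(2) by simp
  qed
  then show "\<exists>N. \<forall>m\<ge>N. \<forall>n\<ge>N. U (r m - r n) < e" by blast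
qed

text \<open>The counterpart for equivalent sequences. Besides compatibility of the operations it
  yields transitivity of \<open>null_rel\<close>, with both coefficients equal to 1.\<close>

lemma null_dominated:
  assumes s: "(s, s') \<in> null_rel S R" and t: "(t, t') \<in> null_rel S R" and r: "r \<in> C" "r' \<in> C"
    and le: "\<And>n. U (r n - r' n) \<le> a * U (s n - s' n) + b * U (t n - t' n)"
  shows "(r, r') \<in> null_rel S R"
proof -
  have "(\<lambda>n. a * U (s n - s' n) + b * U (t n - t' n)) \<longlonglongrightarrow> a * 0 + b * 0"
    using s t by (intro tendsto_intros) (auto simp: null_rel_def)
  then have lim: "(\<lambda>n. a * U (s n - s' n) + b * U (t n - t' n)) \<longlonglongrightarrow> 0"
    by simp
  have "(\<lambda>n. U (r n - r' n)) \<longlonglongrightarrow> 0"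
  proof (rule tendsto_sandwich[of "\<lambda>_. 0", OF _ _ _ lim])
    show "\<forall>\<^sub>F n in sequentially. 0 \<le> U (r n - r' n)"
      by (intro always_eventually allI U_nonneg diff_free cauchy_free r)
    show "\<forall>\<^sub>F n in sequentially. U (r n - r' n) \<le> a * U (s n - s' n) + b * U (t n - t' n)"
      by (intro always_eventually allI le)
  qed simp_all
  then show ?thesis using r by (simp add: null_rel_def)
qed

lemma null_relD: "(s, t) \<in> null_rel S R \<Longrightarrow> s \<in> C \<and> t \<in> C"
  by (simp add: null_rel_def)

lemma null_rel_refl: "s \<in> C \<Longrightarrow> (s, s) \<in> null_rel S R"
  by (simp add: null_rel_def U_zero)

lemma equiv_null_rel: "equiv C (null_rel S R)"
proof (rule equivI)
  show "null_rel S R \<subseteq> C \<times> C" by (auto simp: null_rel_def)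
  show "refl_on C (null_rel S R)" by (auto simp: refl_on_def null_rel_def U_zero)
  show "sym (null_rel S R)"
    using U_diff_commute cauchy_free by (auto simp: sym_def null_rel_def)
  show "trans (null_rel S R)"
  proof (rule transI)
    fix r s t assume rs: "(r, s) \<in> null_rel S R" and st: "(s, t) \<in> null_rel S R"
    then show "(r, t) \<in> null_rel S R"
      using null_relD[OF rs] null_relD[OF st] cauchy_free U_triangle
      by (intro null_dominated[OF rs st, of _ _ 1 1]) auto
  qed
qed

lemma cls_eqI: "(s, t) \<in> null_rel S R \<Longrightarrow> cls s = cls t"
  unfolding cls_def by (rule equiv_class_eq[OF equiv_null_rel])

lemma carrier_eq: "carrier A = cls ` C"
  by (auto simp: universal_cstar_algebra_def quotient_def cls_def)

lemma cls_carrier: "s \<in> C \<Longrightarrow> cls s \<in> carrier A"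
  by (simp add: carrier_eq)

text \<open>The operations of the algebra are unions over all representatives. A Lipschitz map
  respects the equivalence, so the union collapses to the class of a single image sequence.\<close>

lemma lift_unary:
  assumes "a \<ge> 0" "s \<in> C" and f: "\<And>p. p \<in> F \<Longrightarrow> f p \<in> F"
    and le: "\<And>p q. p \<in> F \<Longrightarrow> q \<in> F \<Longrightarrow> U (f p - f q) \<le> a * U (p - q)"
  shows "(\<lambda>n. f (s n)) \<in> C"
    and "(\<Union>s\<in>cls s. null_rel S R `` {\<lambda>n. f (s n)}) = cls (\<lambda>n. f (s n))"
proof -
  have C: "(\<lambda>n. f (s n)) \<in> C" if "s \<in> C" for s
    using that assms cauchy_free[OF that]
    by (intro cauchy_dominated[OF that that, of _ a 0]) auto
  then show "(\<lambda>n. f (s n)) \<in> C" using assms by simp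
  have "((\<lambda>n. f (s n)), (\<lambda>n. f (t n))) \<in> null_rel S R" if st: "(s, t) \<in> null_rel S R" for s t
    using null_relD[OF st] C le cauchy_free by (intro null_dominated[OF st st, of _ _ a 0]) auto
  then have "congruent (null_rel S R) (\<lambda>s. null_rel S R `` {\<lambda>n. f (s n)})"
    by (auto simp: congruent_def intro!: equiv_class_eq[OF equiv_null_rel])
  from UN_equiv_class[OF equiv_null_rel this \<open>s \<in> C\<close>]
  show "(\<Union>s\<in>cls s. null_rel S R `` {\<lambda>n. f (s n)}) = cls (\<lambda>n. f (s n))"
    by (simp add: cls_def)
qed

text \<open>
  The Lipschitz constant may depend on a bound of the arguments, which multiplication needs;
  Cauchy sequences are bounded.
\<close>

lemma lift_binary:
  assumes "s \<in> C" "t \<in> C"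
    and f: "\<And>p q. p \<in> F \<Longrightarrow> q \<in> F \<Longrightarrow> f p q \<in> F"
    and le: "\<And>M. M \<ge> 0 \<Longrightarrow> \<exists>a\<ge>0. \<forall>p\<in>F. \<forall>q\<in>F. \<forall>p'\<in>F. \<forall>q'\<in>F. U p' \<le> M \<longrightarrow> U q \<le> M \<longrightarrow>
      U (f p q - f p' q') \<le> a * U (p - p') + a * U (q - q')"
  shows "(\<lambda>n. f (s n) (t n)) \<in> C"
    and "(\<Union>s\<in>cls s. \<Union>t\<in>cls t. null_rel S R `` {\<lambda>n. f (s n) (t n)}) = cls (\<lambda>n. f (s n) (t n))"
proof -
  \<comment> \<open>The indices \<open>m\<close> and \<open>n\<close> vary independently: equal
    sequences give the Cauchy estimate, and equal indices give the null estimate. Bounds are taken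
    on \<open>s'\<close> and \<open>t\<close>, the factors that survive when a product is
    telescoped.\<close>
  have bound: "\<exists>a\<ge>0. \<forall>m n. U (f (s m) (t m) - f (s' n) (t' n)) \<le> a * U (s m - s' n) + a * U (t m - t' n)"
    if C: "s \<in> C" "t \<in> C" "s' \<in> C" "t' \<in> C" for s t s' t'
  proof -
    obtain M1 where M1: "M1 \<ge> 0" "\<And>n. U (s' n) \<le> M1" using cauchy_bounded[OF C(3)] by blast
    obtain M2 where M2: "M2 \<ge> 0" "\<And>n. U (t n) \<le> M2" using cauchy_bounded[OF C(2)] by blast
    have "\<And>n. U (s' n) \<le> max M1 M2" "\<And>n. U (t n) \<le> max M1 M2"
      using M1 M2 by (simp_all add: max.coboundedI1 max.coboundedI2)
    then show ?thesis using le[of "max M1 M2"] M1(1) C cauchy_free by (meson max.coboundedI1)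
  qed
  have C: "(\<lambda>n. f (s n) (t n)) \<in> C" if st: "s \<in> C" "t \<in> C" for s t
  proof -
    obtain a where "a \<ge> 0" "\<And>m n. U (f (s m) (t m) - f (s n) (t n)) \<le> a * U (s m - s n) + a * U (t m - t n)"
      using bound[OF st st] by blast
    then show ?thesis using st cauchy_free f by (intro cauchy_dominated[OF st, of _ a a]) auto
  qed
  then show "(\<lambda>n. f (s n) (t n)) \<in> C" using assms by simp
  have "((\<lambda>n. f (s n) (t n)), (\<lambda>n. f (s' n) (t' n))) \<in> null_rel S R"
    if s: "(s, s') \<in> null_rel S R" and t: "(t, t') \<in> null_rel S R" for s s' t t'
  proof -
    obtain a where "\<And>m n. U (f (s m) (t m) - f (s' n) (t' n)) \<le> a * U (s m - s' n) + a * U (t m - t' n)"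
      using bound[of s t s' t'] null_relD[OF s] null_relD[OF t] by blast
    then show ?thesis
      using null_relD[OF s] null_relD[OF t] C by (intro null_dominated[OF s t, of _ _ a a]) auto
  qed
  then have "congruent2 (null_rel S R) (null_rel S R) (\<lambda>s t. null_rel S R `` {\<lambda>n. f (s n) (t n)})"
    by (intro congruent2I' equiv_class_eq[OF equiv_null_rel])
  from UN_equiv_class2[OF equiv_null_rel equiv_null_rel this \<open>s \<in> C\<close> \<open>t \<in> C\<close>]
  show "(\<Union>s\<in>cls s. \<Union>t\<in>cls t. null_rel S R `` {\<lambda>n. f (s n) (t n)}) = cls (\<lambda>n. f (s n) (t n))"
    by (simp add: cls_def)
qed

lemma add_cls:
  assumes "s \<in> C" "t \<in> C"
  shows "(\<lambda>n. s n + t n) \<in> C" "cls s \<oplus>\<^bsub>A\<^esub> cls t = cls (\<lambda>n. s n + t n)"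
proof -
  have "\<exists>a\<ge>0. \<forall>p\<in>F. \<forall>q\<in>F. \<forall>p'\<in>F. \<forall>q'\<in>F. U p' \<le> M \<longrightarrow> U q \<le> M \<longrightarrow>
      U (p + q - (p' + q')) \<le> a * U (p - p') + a * U (q - q')" for M
    using U_add_diff by (intro exI[of _ 1]) auto
  note lift_binary[where f = "(+)", OF assms _ this]
  then show "(\<lambda>n. s n + t n) \<in> C" "cls s \<oplus>\<^bsub>A\<^esub> cls t = cls (\<lambda>n. s n + t n)"
    by (simp_all add: universal_cstar_algebra_def)
qed

lemma mult_cls:
  assumes "s \<in> C" "t \<in> C"
  shows "(\<lambda>n. s n * t n) \<in> C" "cls s \<otimes>\<^bsub>A\<^esub> cls t = cls (\<lambda>n. s n * t n)"
proof -
  have "\<exists>a\<ge>0. \<forall>p\<in>F. \<forall>q\<in>F. \<forall>p'\<in>F. \<forall>q'\<in>F. U p' \<le> M \<longrightarrow> U q \<le> M \<longrightarrow>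
      U (p * q - p' * q') \<le> a * U (p - p') + a * U (q - q')" if M: "M \<ge> 0" for M
  \<comment> \<open>Both remaining factors of the telescoped product, \<open>U q\<close> and
    \<open>U p'\<close>, are at most \<open>M\<close>, which therefore serves as the
    constant.\<close>
  proof (intro exI[of _ M] conjI ballI impI M)
    fix p q p' q' assume F: "p \<in> F" "q \<in> F" "p' \<in> F" "q' \<in> F" and le: "U p' \<le> M" "U q \<le> M"
    have "U (p - p') * U q + U p' * U (q - q') \<le> U (p - p') * M + M * U (q - q')"
      using F le M by (intro add_mono mult_mono U_nonneg) auto
    then show "U (p * q - p' * q') \<le> M * U (p - p') + M * U (q - q')"
      using U_mult_diff[OF F] by (simp add: mult.commute)
  qed
  note lift_binary[where f = "(*)", OF assms _ this]
  then show "(\<lambda>n. s n * t n) \<in> C" "cls s \<otimes>\<^bsub>A\<^esub> cls t = cls (\<lambda>n. s n * t n)"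
    by (simp_all add: universal_cstar_algebra_def)
qed

lemma smult_cls:
  assumes "s \<in> C"
  shows "(\<lambda>n. poly_scale c (s n)) \<in> C" "c \<odot>\<^bsub>A\<^esub> cls s = cls (\<lambda>n. poly_scale c (s n))"
proof -
  have "U (poly_scale c p - poly_scale c q) \<le> cmod c * U (p - q)" if "p \<in> F" "q \<in> F" for p q
    using U_scale[of "p - q" c] that by (simp add: poly_scale_diff)
  note lift_unary[where f = "poly_scale c", OF _ assms _ this]
  then show "(\<lambda>n. poly_scale c (s n)) \<in> C" "c \<odot>\<^bsub>A\<^esub> cls s = cls (\<lambda>n. poly_scale c (s n))"
    by (simp_all add: universal_cstar_algebra_def)
qed

lemma star_cls:
  assumes "s \<in> C"
  shows "(\<lambda>n. poly_star (s n)) \<in> C" "alg_star A (cls s) = cls (\<lambda>n. poly_star (s n))"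
proof -
  have "U (poly_star p - poly_star q) \<le> 1 * U (p - q)" if "p \<in> F" "q \<in> F" for p q
    using U_star[of "p - q"] that by (simp add: poly_star_diff)
  note lift_unary[where f = poly_star, OF _ assms _ this]
  then show "(\<lambda>n. poly_star (s n)) \<in> C" "alg_star A (cls s) = cls (\<lambda>n. poly_star (s n))"
    by (simp_all add: universal_cstar_algebra_def)
qed

lemma one_cls: "\<one>\<^bsub>A\<^esub> = cls (\<lambda>_. 1)"
  by (simp add: universal_cstar_algebra_def cls_def)

lemma universal_gen_cls: "universal_gen S R s = cls (\<lambda>_. gen s)"
  by (simp add: universal_gen_def cls_def)

text \<open>A relator has universal seminorm zero, so the two constant sequences are equivalent and
  the relation becomes an equality in the completion.\<close>

lemma relator_cls:
  assumes "a - b \<in> R" "a \<in> F" "b \<in> F"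
  shows "cls (\<lambda>_. a) = cls (\<lambda>_. b)"
  using assms U_relator[of "a - b"] const_cauchy by (intro cls_eqI) (simp add: null_rel_def)

end

section \<open>Operators on Hilbert spaces\<close>

lemma cinner_add_right: "cinner x (y + z) = cinner x y + cinner x z"
  by (metis cinner_add_left cinner_commute complex_cnj_add)

lemma cinner_scaleC_right: "cinner x (a *\<^sub>C y) = cnj a * cinner x y"
  by (metis cinner_scaleC_left cinner_commute complex_cnj_mult)

lemma cinner_zero_left [simp]: "cinner 0 y = 0"
  using cinner_add_left[of 0 0 y] by simp

lemma cinner_zero_right [simp]: "cinner x 0 = 0"
  using cinner_add_right[of x 0 0] by simp

lemma cinner_sum_left: "cinner (sum f A) y = (\<Sum>i\<in>A. cinner (f i) y)"
  by (induction A rule: infinite_finite_induct) (simp_all add: cinner_add_left)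

lemma cinner_sum_right: "cinner x (sum f A) = (\<Sum>i\<in>A. cinner x (f i))"
  by (induction A rule: infinite_finite_induct) (simp_all add: cinner_add_right)

lemma norm_sq_eq_Re: "(norm x)\<^sup>2 = Re (cinner x x)"
  by (simp add: cinner_self)

text \<open>The class axioms reach the norm of a complex multiple through the inner product, so
  homogeneity is first obtained for the squared norm.\<close>

lemma norm_scaleC: "norm (a *\<^sub>C x) = cmod a * norm x"
proof -
  have "cnj a * a = (complex_of_real (cmod a))\<^sup>2"
    by (metis complex_norm_square mult.commute of_real_power)
  then have "complex_of_real ((norm (a *\<^sub>C x))\<^sup>2) = complex_of_real ((cmod a * norm x)\<^sup>2)"
    unfolding cinner_self[symmetric] cinner_scaleC_left cinner_scaleC_right
    by (simp add: cinner_self power_mult_distrib mult.assoc[symmetric])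
  then have "(norm (a *\<^sub>C x))\<^sup>2 = (cmod a * norm x)\<^sup>2"
    by (simp only: of_real_eq_iff)
  then show ?thesis by (rule power2_eq_imp_eq) simp_all
qed

lemma norm_add_sq: "(norm (x + y))\<^sup>2 = (norm x)\<^sup>2 + (norm y)\<^sup>2 + 2 * Re (cinner x y)"
proof -
  have "Re (cinner y x) = Re (cinner x y)"
    by (subst cinner_commute) simp
  then show ?thesis by (simp add: norm_sq_eq_Re cinner_add_left cinner_add_right)
qed

text \<open>The norm comes with its triangle inequality. Squaring it and cancelling the squares
  yields the bound, which reverses the usual derivation.\<close>

lemma Re_cinner_le: "Re (cinner x y) \<le> norm x * norm y"
  using power_mono[OF norm_triangle_ineq norm_ge_zero, of x y 2]
  by (simp add: norm_add_sq power2_sum)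

lemma cinner_Cauchy_Schwarz: "cmod (cinner x y) \<le> norm x * norm y"
proof (cases "cinner x y = 0")
  case False
  \<comment> \<open>The phase \<open>c\<close> has modulus 1 and rotates the inner product onto the
    nonnegative real axis, where the bound on real parts applies.\<close>
  define c where "c = cnj (cinner x y) / cmod (cinner x y)"
  have "c * cinner x y = cmod (cinner x y)"
    using False by (simp add: c_def mult.commute complex_norm_square[symmetric] power2_eq_square)
  moreover have "cmod c = 1"
    using False by (simp add: c_def norm_divide)
  ultimately show ?thesis
    using Re_cinner_le[of "c *\<^sub>C x" y] by (simp add: cinner_scaleC_left norm_scaleC)
qed simp

text \<open>For real scalars conjugate linearity is plain linearity, so the limit rules for real
  bounded bilinear maps apply to the inner product.\<close>

lemma bounded_bilinear_cinner: "bounded_bilinear cinner"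
proof (rule bounded_bilinear.intro)
  show "\<exists>K. \<forall>x y. norm (cinner x y) \<le> norm x * norm y * K"
    by (intro exI[of _ 1]) (simp add: cinner_Cauchy_Schwarz)
  show "cinner (r *\<^sub>R x) y = r *\<^sub>R cinner x y" for r and x y :: 'a
    by (simp add: scaleC_of_real[symmetric] cinner_scaleC_left scaleR_conv_of_real)
  show "cinner x (r *\<^sub>R y) = r *\<^sub>R cinner x y" for r and x y :: 'a
    by (simp add: scaleC_of_real[symmetric] cinner_scaleC_right scaleR_conv_of_real)
qed (rule cinner_add_left cinner_add_right)+

section \<open>Bounded operators and their adjoints\<close>

lemma clinearI:
  assumes "\<And>x y. f (x + y) = f x + f y" "\<And>c x. f (c *\<^sub>C x) = c *\<^sub>C f x"
  shows "Vector_Spaces.linear (*\<^sub>C) (*\<^sub>C) f"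
  by unfold_locales (rule assms)+

context
  fixes f :: "'h::complex_hilbert_space \<Rightarrow> 'k::complex_hilbert_space"
  assumes f: "Vector_Spaces.linear (*\<^sub>C) (*\<^sub>C) f"
begin

interpretation f: Vector_Spaces.linear "(*\<^sub>C)" "(*\<^sub>C)" f by (rule f)

lemmas clinear_add = f.add and clinear_scaleC = f.scale and clinear_diff = f.diff and clinear_sum = f.sum

end

lemma bounded_operatorsI:
  assumes "bounded_linear T" "\<And>c x. T (c *\<^sub>C x) = c *\<^sub>C T x"
  shows "T \<in> bounded_operators"
  using assms by (auto simp: bounded_operators_def linear_simps(1)[OF assms(1)] intro!: clinearI)

context
  fixes T :: "'h::complex_hilbert_space \<Rightarrow> 'h"
  assumes T: "T \<in> bounded_operators"
begin

lemma op_linear: "Vector_Spaces.linear (*\<^sub>C) (*\<^sub>C) T"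
  and op_bounded_linear: "bounded_linear T"
  using T by (auto simp: bounded_operators_def)

lemmas op_add = clinear_add[OF op_linear]
  and op_scaleC = clinear_scaleC[OF op_linear]
  and op_diff = clinear_diff[OF op_linear]
  and op_sum = clinear_sum[OF op_linear]
  and op_norm_le = onorm[OF op_bounded_linear]

end

lemma op_id: "id \<in> bounded_operators"
  by (rule bounded_operatorsI) (simp_all add: id_def bounded_linear_ident)

lemma op_compose:
  assumes "T1 \<in> bounded_operators" "T2 \<in> bounded_operators"
  shows "T1 \<circ> T2 \<in> bounded_operators"
proof (rule bounded_operatorsI)
  show "bounded_linear (T1 \<circ> T2)"
    unfolding comp_def
    by (rule bounded_linear_compose[OF op_bounded_linear[OF assms(1)] op_bounded_linear[OF assms(2)]])
qed (simp add: op_scaleC[OF assms(1)] op_scaleC[OF assms(2)])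

lemma bounded_linear_scaleC: "bounded_linear ((*\<^sub>C) c)"
proof (rule bounded_linear_intro[of _ "cmod c"])
  show "c *\<^sub>C r *\<^sub>R x = r *\<^sub>R c *\<^sub>C x" for r and x :: 'a
    by (simp add: scaleC_of_real[symmetric] scaleC_scaleC mult.commute)
qed (simp_all add: scaleC_add_right norm_scaleC mult.commute)

lemma op_scale:
  assumes "T \<in> bounded_operators"
  shows "(\<lambda>\<xi>. c *\<^sub>C T \<xi>) \<in> bounded_operators"
  using bounded_linear_compose[OF bounded_linear_scaleC op_bounded_linear[OF assms]]
  by (intro bounded_operatorsI) (simp_all add: op_scaleC[OF assms] scaleC_scaleC mult.commute)

lemma op_plus:
  assumes "T1 \<in> bounded_operators" "T2 \<in> bounded_operators"
  shows "(\<lambda>\<xi>. T1 \<xi> + T2 \<xi>) \<in> bounded_operators"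
  using bounded_linear_add[OF op_bounded_linear[OF assms(1)] op_bounded_linear[OF assms(2)]]
  by (intro bounded_operatorsI)
    (simp_all add: op_scaleC[OF assms(1)] op_scaleC[OF assms(2)] scaleC_add_right)

lemma op_zero_fun: "(\<lambda>_. 0) \<in> bounded_operators"
  by (rule bounded_operatorsI) simp_all

lemma op_sum_fun: "(\<And>i. i \<in> A \<Longrightarrow> T i \<in> bounded_operators) \<Longrightarrow> (\<lambda>\<xi>. \<Sum>i\<in>A. T i \<xi>) \<in> bounded_operators"
  by (induction A rule: infinite_finite_induct) (auto intro: op_plus op_zero_fun)

text \<open>Adjointness is a relation between two given maps: the adjoints that occur are explicit,
  such as inverses of unitaries and coordinates of a similarity.\<close>

definition adjoint_ops :: "('h::complex_hilbert_space \<Rightarrow> 'h) \<Rightarrow> ('h \<Rightarrow> 'h) \<Rightarrow> bool" where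
  "adjoint_ops T T' \<longleftrightarrow> (\<forall>\<xi> \<eta>. cinner (T' \<xi>) \<eta> = cinner \<xi> (T \<eta>))"

lemma adjoint_opsD: "adjoint_ops T T' \<Longrightarrow> cinner (T' \<xi>) \<eta> = cinner \<xi> (T \<eta>)"
  by (simp add: adjoint_ops_def)

lemma adjoint_ops_sym: "adjoint_ops T T' \<Longrightarrow> adjoint_ops T' T"
  unfolding adjoint_ops_def by (metis cinner_commute)

lemma adjoint_ops_compose:
  "adjoint_ops T1 T1' \<Longrightarrow> adjoint_ops T2 T2' \<Longrightarrow> adjoint_ops (T1 \<circ> T2) (T2' \<circ> T1')"
  by (simp add: adjoint_ops_def)

text \<open>The squared norm of \<open>T' \<xi>\<close> is the inner product of \<xi> with
  \<open>T (T' \<xi>)\<close>. Bounding the latter by Cauchy-Schwarz leaves one factor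
  \<open>norm (T' \<xi>)\<close> to cancel.\<close>

lemma onorm_adjoint_le:
  assumes T: "T \<in> bounded_operators" "T' \<in> bounded_operators" and adj: "adjoint_ops T T'"
  shows "onorm T' \<le> onorm T"
proof (rule onorm_bound)
  show "0 \<le> onorm T" by (rule onorm_pos_le[OF op_bounded_linear[OF T(1)]])
  fix \<xi>
  have "norm (T' \<xi>) * norm (T' \<xi>) = Re (cinner \<xi> (T (T' \<xi>)))"
    by (simp add: power2_eq_square[symmetric] norm_sq_eq_Re adjoint_opsD[OF adj])
  also have "\<dots> \<le> norm \<xi> * norm (T (T' \<xi>))" by (rule Re_cinner_le)
  also have "\<dots> \<le> norm \<xi> * (onorm T * norm (T' \<xi>))"
    by (intro mult_left_mono op_norm_le[OF T(1)]) simp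
  finally have "norm (T' \<xi>) * norm (T' \<xi>) \<le> (onorm T * norm \<xi>) * norm (T' \<xi>)"
    by (simp add: mult_ac)
  then show "norm (T' \<xi>) \<le> onorm T * norm \<xi>"
    using onorm_pos_le[OF op_bounded_linear[OF T(1)]]
    by (cases "T' \<xi> = 0") (simp_all add: mult_le_cancel_right)
qed

text \<open>One inequality of this C*-identity is submultiplicativity with
  \<open>onorm_adjoint_le\<close>. The other bounds \<open>(norm (T \<xi>))\<^sup>2\<close> by
  moving one \<open>T\<close> across the inner product.\<close>

lemma onorm_adjoint_comp:
  assumes T: "T \<in> bounded_operators" "T' \<in> bounded_operators" and adj: "adjoint_ops T T'"
  shows "onorm (T' \<circ> T) = (onorm T)\<^sup>2"
proof (rule antisym)
  note bl = op_bounded_linear[OF T(1)] op_bounded_linear[OF T(2)]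
  note comp = op_compose[OF T(2,1)]
  have "onorm (T' \<circ> T) \<le> onorm T' * onorm T" by (rule onorm_compose[OF bl(2,1)])
  also have "\<dots> \<le> onorm T * onorm T"
    by (intro mult_right_mono onorm_adjoint_le T adj onorm_pos_le bl)
  finally show "onorm (T' \<circ> T) \<le> (onorm T)\<^sup>2" by (simp add: power2_eq_square)
  have pos: "0 \<le> onorm (T' \<circ> T)" by (rule onorm_pos_le[OF op_bounded_linear[OF comp]])
  have "onorm T \<le> sqrt (onorm (T' \<circ> T))"
  proof (rule onorm_bound)
    fix \<xi>
    have "(norm (T \<xi>))\<^sup>2 = Re (cinner (T' (T \<xi>)) \<xi>)"
      by (simp add: norm_sq_eq_Re adjoint_opsD[OF adj])
    also have "\<dots> \<le> norm ((T' \<circ> T) \<xi>) * norm \<xi>" using Re_cinner_le by simp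
    also have "\<dots> \<le> (onorm (T' \<circ> T) * norm \<xi>) * norm \<xi>"
      by (intro mult_right_mono op_norm_le[OF comp]) simp
    also have "\<dots> = (sqrt (onorm (T' \<circ> T)) * norm \<xi>)\<^sup>2"
      using pos by (simp add: power_mult_distrib power2_eq_square)
    finally show "norm (T \<xi>) \<le> sqrt (onorm (T' \<circ> T)) * norm \<xi>"
      by (rule power2_le_imp_le) (simp add: pos)
  qed (simp add: pos)
  then show "(onorm T)\<^sup>2 \<le> onorm (T' \<circ> T)"
    using power_mono[of "onorm T" "sqrt (onorm (T' \<circ> T))" 2] pos onorm_pos_le[OF bl(1)] by simp
qed

lemma onorm_scaleC:
  assumes "T \<in> bounded_operators"
  shows "onorm (\<lambda>\<xi>. c *\<^sub>C T \<xi>) = cmod c * onorm T"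
proof -
  \<comment> \<open>The operator norm sees only the norms of values, so the complex factor may be
    replaced by its modulus.\<close>
  have "onorm (\<lambda>\<xi>. c *\<^sub>C T \<xi>) = onorm (\<lambda>\<xi>. cmod c *\<^sub>R T \<xi>)"
    by (simp add: onorm_def norm_scaleC)
  then show ?thesis using onorm_scaleR[OF op_bounded_linear[OF assms]] by simp
qed

section \<open>Evaluation of *-polynomials in operators\<close>

primrec letter_op :: "('s \<Rightarrow> 'h \<Rightarrow> 'h) \<Rightarrow> ('s \<Rightarrow> 'h \<Rightarrow> 'h) \<Rightarrow> 's star_letter \<Rightarrow> 'h \<Rightarrow> 'h" where
  "letter_op T T' (Gen s) = T s"
| "letter_op T T' (Adj s) = T' s"

definition word_op :: "('s \<Rightarrow> 'h \<Rightarrow> 'h) \<Rightarrow> ('s \<Rightarrow> 'h \<Rightarrow> 'h) \<Rightarrow> 's star_word \<Rightarrow> 'h \<Rightarrow> 'h" where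
  "word_op T T' w = foldr (\<lambda>l f. letter_op T T' l \<circ> f) (letters w) id"

definition poly_op :: "('s \<Rightarrow> 'h \<Rightarrow> 'h) \<Rightarrow> ('s \<Rightarrow> 'h \<Rightarrow> 'h) \<Rightarrow> 's star_poly
    \<Rightarrow> 'h::complex_hilbert_space \<Rightarrow> 'h" where
  "poly_op T T' p \<xi> = (\<Sum>w\<in>Poly_Mapping.keys p. Poly_Mapping.lookup p w *\<^sub>C word_op T T' w \<xi>)"

lemma word_op_plus: "word_op T T' (v + w) = word_op T T' v \<circ> word_op T T' w"
proof -
  have "foldr (\<lambda>l f. letter_op T T' l \<circ> f) ls g = foldr (\<lambda>l f. letter_op T T' l \<circ> f) ls id \<circ> g" for ls g
    by (induction ls) (simp_all add: comp_assoc)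
  then show ?thesis by (simp add: word_op_def plus_star_word_def)
qed

lemma word_op_Nil [simp]: "word_op T T' (Word []) = id"
  and word_op_zero [simp]: "word_op T T' 0 = id"
  and word_op_Cons: "word_op T T' (Word (l # ls)) = letter_op T T' l \<circ> word_op T T' (Word ls)"
  by (simp_all add: word_op_def zero_star_word_def)

text \<open>Cancellation can remove keys from a sum, so additivity is checked over a common finite
  set of words.\<close>

lemma poly_op_superset:
  assumes "finite B" "Poly_Mapping.keys p \<subseteq> B"
  shows "poly_op T T' p \<xi> = (\<Sum>w\<in>B. Poly_Mapping.lookup p w *\<^sub>C word_op T T' w \<xi>)"
  unfolding poly_op_def using assms
  by (intro sum.mono_neutral_left) (auto simp: in_keys_iff)

lemma poly_op_add: "poly_op T T' (p + q) \<xi> = poly_op T T' p \<xi> + poly_op T T' q \<xi>"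
  by (simp add: poly_op_superset[of "Poly_Mapping.keys p \<union> Poly_Mapping.keys q"] keys_add
      lookup_add scaleC_add_left sum.distrib)

lemma poly_op_single: "poly_op T T' (Poly_Mapping.single w c) \<xi> = c *\<^sub>C word_op T T' w \<xi>"
  by (simp add: poly_op_def)

lemma poly_op_zero [simp]: "poly_op T T' 0 \<xi> = 0"
  by (simp add: poly_op_def)

lemma poly_op_one [simp]: "poly_op T T' 1 = id"
  using poly_op_single[of T T' 0 1] by (auto simp: fun_eq_iff)

lemma poly_op_gen [simp]: "poly_op T T' (gen s) = T s"
  by (simp add: gen_def fun_eq_iff poly_op_single word_op_def)

lemma poly_op_star_gen [simp]: "poly_op T T' (poly_star (gen s)) = T' s"
  by (simp add: gen_def fun_eq_iff poly_op_single word_op_def word_star_def)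

lemma poly_op_diff: "poly_op T T' (p - q) \<xi> = poly_op T T' p \<xi> - poly_op T T' q \<xi>"
  using poly_op_add[of T T' "p - q" q] by (simp add: algebra_simps)

lemma poly_op_sum: "poly_op T T' (sum f A) \<xi> = (\<Sum>i\<in>A. poly_op T T' (f i) \<xi>)"
  by (induction A rule: infinite_finite_induct) (simp_all add: poly_op_add)

locale operator_family =
  fixes S :: "'s set" and T T' :: "'s \<Rightarrow> 'h::complex_hilbert_space \<Rightarrow> 'h"
  assumes op: "s \<in> S \<Longrightarrow> T s \<in> bounded_operators"
    and adj_op: "s \<in> S \<Longrightarrow> T' s \<in> bounded_operators"
    and adj: "s \<in> S \<Longrightarrow> adjoint_ops (T s) (T' s)"
begin

lemma word_op_bounded: "word_gens w \<subseteq> S \<Longrightarrow> word_op T T' w \<in> bounded_operators"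
proof (induction "letters w" arbitrary: w)
  case Nil
  then show ?case using op_id by (cases w) (simp add: id_def)
next
  case (Cons l ls)
  then have w: "w = Word (l # ls)" by (cases w) simp
  have "letter_op T T' l \<in> bounded_operators"
    using Cons.prems by (cases l) (simp_all add: w op adj_op)
  then show ?case
    using Cons.hyps(1)[of "Word ls"] Cons.prems by (simp add: w word_op_Cons op_compose)
qed

lemma word_op_adjoint: "word_gens w \<subseteq> S \<Longrightarrow> adjoint_ops (word_op T T' w) (word_op T T' (word_star w))"
proof (induction "letters w" arbitrary: w)
  case Nil
  then show ?case by (cases w) (simp add: adjoint_ops_def word_star_def)
next
  case (Cons l ls)
  then have w: "w = Word (l # ls)" by (cases w) simp
  have "adjoint_ops (letter_op T T' l) (letter_op T T' (letter_star l))"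
    using Cons.prems by (cases l) (simp_all add: w adj adjoint_ops_sym)
  \<comment> \<open>Reversal sends the first letter of the word to the end, in agreement with the
    reversed order of adjoints in a composition.\<close>
  moreover have "word_star w = word_star (Word ls) + Word [letter_star l]"
    by (simp add: w word_star_def plus_star_word_def)
  ultimately show ?case
    using Cons.hyps(1)[of "Word ls"] Cons.prems
    by (simp add: w word_op_Cons word_op_plus adjoint_ops_compose)
qed

lemma poly_op_bounded:
  assumes "p \<in> free_star_algebra S"
  shows "poly_op T T' p \<in> bounded_operators"
proof -
  have "(\<lambda>\<xi>. \<Sum>w\<in>Poly_Mapping.keys p. Poly_Mapping.lookup p w *\<^sub>C word_op T T' w \<xi>) \<in> bounded_operators"
    using keys_free[OF assms] by (intro op_sum_fun op_scale word_op_bounded)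
  then show ?thesis by (simp add: poly_op_def[abs_def])
qed

text \<open>The condition falls on the left factor because its word operators must be linear to be
  moved past the sum for \<open>q\<close>.\<close>

lemma poly_op_mult:
  assumes "p \<in> free_star_algebra S"
  shows "poly_op T T' (p * q) = poly_op T T' p \<circ> poly_op T T' q"
proof
  fix \<xi>
  let ?l = Poly_Mapping.lookup and ?k = Poly_Mapping.keys
  have "p * q = (\<Sum>v\<in>?k p. \<Sum>w\<in>?k q. Poly_Mapping.single (v + w) (?l p v * ?l q w))"
    by (subst poly_mapping_expand[of p], subst poly_mapping_expand[of q])
      (simp add: sum_product mult_single)
  then have "poly_op T T' (p * q) \<xi>
      = (\<Sum>v\<in>?k p. \<Sum>w\<in>?k q. ?l p v *\<^sub>C (?l q w *\<^sub>C word_op T T' v (word_op T T' w \<xi>)))"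
    by (simp add: poly_op_sum poly_op_single word_op_plus scaleC_scaleC)
  also have "\<dots> = (\<Sum>v\<in>?k p. ?l p v *\<^sub>C word_op T T' v (poly_op T T' q \<xi>))"
  proof (rule sum.cong[OF refl])
    fix v assume "v \<in> ?k p"
    then have v: "word_op T T' v \<in> bounded_operators"
      using keys_free[OF assms] word_op_bounded by blast
    show "(\<Sum>w\<in>?k q. ?l p v *\<^sub>C (?l q w *\<^sub>C word_op T T' v (word_op T T' w \<xi>)))
        = ?l p v *\<^sub>C word_op T T' v (poly_op T T' q \<xi>)"
      by (simp add: poly_op_def op_sum[OF v] op_scaleC[OF v] complex_vector.scale_sum_right)
  qed
  also have "\<dots> = (poly_op T T' p \<circ> poly_op T T' q) \<xi>" by (simp add: poly_op_def)
  finally show "poly_op T T' (p * q) \<xi> = (poly_op T T' p \<circ> poly_op T T' q) \<xi>" .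
qed

lemma poly_op_scale: "poly_op T T' (poly_scale c p) = (\<lambda>\<xi>. c *\<^sub>C poly_op T T' p \<xi>)"
  using poly_op_mult[of "Poly_Mapping.single 0 c" p]
  by (simp add: poly_scale_eq_mult fun_eq_iff poly_op_single)

lemma poly_op_adjoint:
  assumes "p \<in> free_star_algebra S"
  shows "adjoint_ops (poly_op T T' p) (poly_op T T' (poly_star p))"
  unfolding adjoint_ops_def
proof (intro allI)
  fix \<xi> \<eta>
  have "cinner (poly_op T T' (poly_star p) \<xi>) \<eta>
      = (\<Sum>w\<in>Poly_Mapping.keys p.
          cnj (Poly_Mapping.lookup p w) * cinner (word_op T T' (word_star w) \<xi>) \<eta>)"
    by (simp add: poly_star_def poly_op_sum poly_op_single cinner_sum_left cinner_scaleC_left)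
  also have "\<dots> = (\<Sum>w\<in>Poly_Mapping.keys p.
      cnj (Poly_Mapping.lookup p w) * cinner \<xi> (word_op T T' w \<eta>))"
    using adjoint_opsD[OF word_op_adjoint[OF keys_free[OF assms]]]
    by (intro sum.cong) simp_all
  also have "\<dots> = cinner \<xi> (poly_op T T' p \<eta>)"
    by (simp add: poly_op_def cinner_sum_right cinner_scaleC_right)
  finally show "cinner (poly_op T T' (poly_star p) \<xi>) \<eta> = cinner \<xi> (poly_op T T' p \<eta>)" .
qed

text \<open>Places the operator norm of an evaluation among the C*-seminorms that compete in the
  supremum. The C*-identity is inherited from operators and their adjoints.\<close>

lemma onorm_poly_op_seminorm: "cstar_seminorm S (\<lambda>p. onorm (poly_op T T' p))"
  unfolding cstar_seminorm_def
proof (intro conjI ballI allI)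
  fix a b assume a: "a \<in> free_star_algebra S" and b: "b \<in> free_star_algebra S"
  note bl = op_bounded_linear[OF poly_op_bounded[OF a]] op_bounded_linear[OF poly_op_bounded[OF b]]
  show "onorm (poly_op T T' (a + b)) \<le> onorm (poly_op T T' a) + onorm (poly_op T T' b)"
    using onorm_triangle[OF bl] by (simp add: poly_op_add[abs_def])
  show "onorm (poly_op T T' (a * b)) \<le> onorm (poly_op T T' a) * onorm (poly_op T T' b)"
    using onorm_compose[OF bl] by (simp add: poly_op_mult[OF a])
next
  fix c a assume "a \<in> free_star_algebra S"
  then show "onorm (poly_op T T' (poly_scale c a)) = cmod c * onorm (poly_op T T' a)"
    by (simp add: poly_op_scale onorm_scaleC poly_op_bounded)
next
  fix a assume "a \<in> free_star_algebra S"
  then show "onorm (poly_op T T' (poly_star a * a)) = (onorm (poly_op T T' a))\<^sup>2"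
    by (simp add: poly_op_mult onorm_adjoint_comp poly_op_bounded poly_op_adjoint)
qed

end

section \<open>The universal property\<close>

locale relation_model = bounded_relations S R + operator_family S T T'
  for S :: "'s set" and R and T T' :: "'s \<Rightarrow> 'h::complex_hilbert_space \<Rightarrow> 'h" +
  assumes relators_vanish: "r \<in> R \<Longrightarrow> poly_op T T' r = (\<lambda>_. 0)"
    and nonzero_vector: "\<exists>\<xi>::'h. \<xi> \<noteq> 0"
begin

abbreviation ev :: "'s star_poly \<Rightarrow> 'h \<Rightarrow> 'h" where "ev \<equiv> poly_op T T'"

text \<open>Since the relators evaluate to zero, the operator norm of \<open>ev\<close> is
  admissible and hence at most \<open>U\<close>. The continuity of evaluation rests on this
  estimate.\<close>

lemma norm_ev_le:
  assumes "a \<in> F"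
  shows "norm (ev a \<xi>) \<le> U a * norm \<xi>"
proof -
  have "(\<lambda>p. onorm (ev p)) \<in> admissible"
    by (simp add: admissible_def onorm_poly_op_seminorm relators_vanish onorm_zero)
  then have "onorm (ev a) \<le> U a" using U_upper assms by blast
  then show ?thesis
    using op_norm_le[OF poly_op_bounded[OF assms], of \<xi>] by (meson mult_right_mono norm_ge_zero order.trans)
qed

text \<open>The limit is taken along an arbitrarily chosen representative; \<open>ev_tendsto\<close>
  shows that every representative has the same limit.\<close>

definition extension :: "(nat \<Rightarrow> 's star_poly) set \<Rightarrow> 'h \<Rightarrow> 'h" where
  "extension K \<xi> = lim (\<lambda>n. ev ((SOME s. s \<in> K) n) \<xi>)"

lemma ev_convergent:
  assumes s: "s \<in> C"
  shows "convergent (\<lambda>n. ev (s n) \<xi>)"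
proof (rule Cauchy_convergent, rule metric_CauchyI)
  fix e :: real assume e: "e > 0"
  \<comment> \<open>Adding 1 avoids division by zero for \<xi> = 0 and makes the last inequality
    strict.\<close>
  have pos: "norm \<xi> + 1 > 0" by (simp add: add_nonneg_pos)
  obtain N where N: "\<forall>m\<ge>N. \<forall>n\<ge>N. U (s m - s n) < e / (norm \<xi> + 1)"
    using cauchyD[OF s, of "e / (norm \<xi> + 1)"] e pos by auto
  have "dist (ev (s m) \<xi>) (ev (s n) \<xi>) < e" if "m \<ge> N" "n \<ge> N" for m n
  proof -
    have "dist (ev (s m) \<xi>) (ev (s n) \<xi>) \<le> U (s m - s n) * norm \<xi>"
      using norm_ev_le[of "s m - s n" \<xi>] cauchy_free[OF s] by (simp add: dist_norm poly_op_diff)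
    also have "\<dots> \<le> e / (norm \<xi> + 1) * norm \<xi>"
      using N that by (intro mult_right_mono) (auto intro: less_imp_le)
    also have "\<dots> < e" using e pos by (simp add: divide_less_eq)
    finally show ?thesis .
  qed
  then show "\<exists>N. \<forall>m\<ge>N. \<forall>n\<ge>N. dist (ev (s m) \<xi>) (ev (s n) \<xi>) < e" by blast
qed

text \<open>A representative differs from the chosen one by a null sequence, which
  \<open>norm_ev_le\<close> turns into a null sequence of vectors.\<close>

lemma ev_tendsto:
  assumes s: "s \<in> C"
  shows "(\<lambda>n. ev (s n) \<xi>) \<longlonglongrightarrow> extension (cls s) \<xi>"
proof -
  define t where "t = (SOME t. t \<in> cls s)"
  have "s \<in> cls s" using null_rel_refl[OF s] by (simp add: cls_def)
  then have "t \<in> cls s" unfolding t_def by (rule someI[of "\<lambda>t. t \<in> cls s"])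
  then have st: "(s, t) \<in> null_rel S R" by (simp add: cls_def)
  then have t: "t \<in> C" and lim0: "(\<lambda>n. U (s n - t n)) \<longlonglongrightarrow> 0" by (simp_all add: null_rel_def)
  have "(\<lambda>n. U (s n - t n) * norm \<xi>) \<longlonglongrightarrow> 0"
    using tendsto_mult_right[OF lim0, of "norm \<xi>"] by simp
  then have "(\<lambda>n. ev (s n) \<xi> - ev (t n) \<xi>) \<longlonglongrightarrow> 0"
  proof (rule Lim_null_comparison[rotated])
    show "\<forall>\<^sub>F n in sequentially. norm (ev (s n) \<xi> - ev (t n) \<xi>) \<le> U (s n - t n) * norm \<xi>"
      using norm_ev_le[OF diff_free[OF cauchy_free[OF s] cauchy_free[OF t]]]
      by (simp add: poly_op_diff)
  qed
  moreover have "(\<lambda>n. ev (t n) \<xi>) \<longlonglongrightarrow> extension (cls s) \<xi>"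
    using ev_convergent[OF t] by (simp add: extension_def t_def[symmetric] convergent_LIMSEQ_iff)
  ultimately show ?thesis using tendsto_add by fastforce
qed

lemma extension_eqI: "s \<in> C \<Longrightarrow> (\<lambda>n. ev (s n) \<xi>) \<longlonglongrightarrow> \<eta> \<Longrightarrow> extension (cls s) \<xi> = \<eta>"
  by (rule LIMSEQ_unique[OF ev_tendsto])

lemma extension_const: "a \<in> F \<Longrightarrow> extension (cls (\<lambda>_. a)) = ev a"
  by (intro ext extension_eqI const_cauchy tendsto_const)

lemma extension_bounded:
  assumes s: "s \<in> C"
  shows "extension (cls s) \<in> bounded_operators"
proof (rule bounded_operatorsI)
  note op = poly_op_bounded[OF cauchy_free[OF s]]
  have add: "extension (cls s) (\<xi> + \<eta>) = extension (cls s) \<xi> + extension (cls s) \<eta>" for \<xi> \<eta>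
    using tendsto_add[OF ev_tendsto[OF s] ev_tendsto[OF s]] by (intro extension_eqI s) (simp add: op_add[OF op])
  show scale: "extension (cls s) (c *\<^sub>C \<xi>) = c *\<^sub>C extension (cls s) \<xi>" for c \<xi>
    using bounded_linear.tendsto[OF bounded_linear_scaleC ev_tendsto[OF s]]
    by (intro extension_eqI s) (simp add: op_scaleC[OF op])
  obtain M where M: "\<And>n. U (s n) \<le> M" using cauchy_bounded[OF s] by blast
  have "norm (extension (cls s) \<xi>) \<le> norm \<xi> * M" for \<xi>
  proof (rule LIMSEQ_le_const2[OF tendsto_norm[OF ev_tendsto[OF s]]])
    have "norm (ev (s n) \<xi>) \<le> norm \<xi> * M" for n
      using norm_ev_le[OF cauchy_free[OF s], of n \<xi>] mult_right_mono[OF M norm_ge_zero, of n \<xi>]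
      by (simp add: mult.commute)
    then show "\<exists>N. \<forall>n\<ge>N. norm (ev (s n) \<xi>) \<le> norm \<xi> * M" by blast
  qed
  then show "bounded_linear (extension (cls s))"
    using add scale by (intro bounded_linear_intro[of _ M]) (simp_all add: scaleC_of_real[symmetric])
qed

text \<open>The operators \<open>ev (s n)\<close> are uniformly bounded by \<open>M\<close>, so
  replacing \<open>ev (t n) \<xi>\<close> by its limit inside them costs an error that tends to
  zero.\<close>

lemma extension_mult:
  assumes s: "s \<in> C" and t: "t \<in> C"
  shows "extension (cls (\<lambda>n. s n * t n)) \<xi> = extension (cls s) (extension (cls t) \<xi>)"
proof (rule extension_eqI[OF mult_cls(1)[OF s t]])
  let ?\<eta> = "extension (cls t) \<xi>"
  obtain M where M: "\<And>n. U (s n) \<le> M" using cauchy_bounded[OF s] by blast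
  have "(\<lambda>n. M * norm (ev (t n) \<xi> - ?\<eta>)) \<longlonglongrightarrow> 0"
    using tendsto_mult_left[OF tendsto_norm_zero[OF LIM_zero[OF ev_tendsto[OF t]]], of M \<xi>] by simp
  then have "(\<lambda>n. ev (s n) (ev (t n) \<xi> - ?\<eta>)) \<longlonglongrightarrow> 0"
  proof (rule Lim_null_comparison[rotated])
    have "norm (ev (s n) (ev (t n) \<xi> - ?\<eta>)) \<le> M * norm (ev (t n) \<xi> - ?\<eta>)" for n
      using norm_ev_le[OF cauchy_free[OF s]] mult_right_mono[OF M norm_ge_zero] order.trans by blast
    then show "\<forall>\<^sub>F n in sequentially. norm (ev (s n) (ev (t n) \<xi> - ?\<eta>)) \<le> M * norm (ev (t n) \<xi> - ?\<eta>)"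
      by simp
  qed
  from tendsto_add[OF this ev_tendsto[OF s, of ?\<eta>]]
  show "(\<lambda>n. ev (s n * t n) \<xi>) \<longlonglongrightarrow> extension (cls s) ?\<eta>"
    using cauchy_free[OF s] by (simp add: poly_op_mult op_diff[OF poly_op_bounded])
qed

theorem star_representation_extension: "star_representation A extension"
  unfolding star_representation_def carrier_eq ball_simps
proof (intro conjI ballI allI nonzero_vector extension_bounded)
  fix s t assume s: "s \<in> C" and t: "t \<in> C"
  show "extension (cls s \<oplus>\<^bsub>A\<^esub> cls t) = (\<lambda>\<xi>. extension (cls s) \<xi> + extension (cls t) \<xi>)"
    unfolding add_cls(2)[OF s t]
    using tendsto_add[OF ev_tendsto[OF s] ev_tendsto[OF t]]
    by (intro ext extension_eqI add_cls(1) s t) (simp add: poly_op_add)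
  show "extension (cls s \<otimes>\<^bsub>A\<^esub> cls t) = extension (cls s) \<circ> extension (cls t)"
    by (simp add: mult_cls(2)[OF s t] extension_mult[OF s t] fun_eq_iff)
next
  fix c s assume s: "s \<in> C"
  show "extension (c \<odot>\<^bsub>A\<^esub> cls s) = (\<lambda>\<xi>. c *\<^sub>C extension (cls s) \<xi>)"
    unfolding smult_cls(2)[OF s]
    using bounded_linear.tendsto[OF bounded_linear_scaleC ev_tendsto[OF s]]
    by (intro ext extension_eqI smult_cls(1) s) (simp add: poly_op_scale)
next
  show "extension \<one>\<^bsub>A\<^esub> = id" by (simp add: one_cls extension_const)
next
  fix s \<xi> \<eta> assume s: "s \<in> C"
  note tendsto_cinner = bounded_bilinear.tendsto[OF bounded_bilinear_cinner]
  have "(\<lambda>n. cinner (ev (poly_star (s n)) \<xi>) \<eta>) \<longlonglongrightarrow> cinner (extension (alg_star A (cls s)) \<xi>) \<eta>"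
    unfolding star_cls(2)[OF s] by (intro tendsto_cinner tendsto_const ev_tendsto[OF star_cls(1)[OF s]])
  moreover have "cinner (ev (poly_star (s n)) \<xi>) \<eta> = cinner \<xi> (ev (s n) \<eta>)" for n
    by (rule adjoint_opsD[OF poly_op_adjoint[OF cauchy_free[OF s]]])
  \<comment> \<open>Both sides of the adjoint identity are limits of the same sequence of inner
    products.\<close>
  ultimately have "(\<lambda>n. cinner \<xi> (ev (s n) \<eta>)) \<longlonglongrightarrow> cinner (extension (alg_star A (cls s)) \<xi>) \<eta>"
    by simp
  moreover have "(\<lambda>n. cinner \<xi> (ev (s n) \<eta>)) \<longlonglongrightarrow> cinner \<xi> (extension (cls s) \<eta>)"
    by (intro tendsto_cinner tendsto_const ev_tendsto[OF s])
  ultimately show "cinner (extension (alg_star A (cls s)) \<xi>) \<eta> = cinner \<xi> (extension (cls s) \<eta>)"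
    by (rule LIMSEQ_unique)
qed

theorem universal_property:
  "\<exists>\<Phi> :: _ \<Rightarrow> 'h \<Rightarrow> 'h. star_representation A \<Phi> \<and> (\<forall>s\<in>S. \<Phi> (universal_gen S R s) = T s)"
  using star_representation_extension
  by (intro exI[of _ extension]) (simp add: universal_gen_cls extension_const)

end

section \<open>Cuntz families and similarities\<close>

context
  fixes f :: "'h::complex_hilbert_space \<Rightarrow> 'k::complex_hilbert_space"
  assumes f: "hilbert_isomorphism f"
begin

lemma hilbert_iso_linear: "Vector_Spaces.linear (*\<^sub>C) (*\<^sub>C) f"
  and hilbert_iso_surj: "surj f"
  and hilbert_iso_norm: "norm (f \<xi>) = norm \<xi>"
  using f by (auto simp: hilbert_isomorphism_def)

lemma hilbert_iso_inj: "inj f"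
proof (rule injI)
  fix \<xi> \<eta> assume "f \<xi> = f \<eta>"
  then have "f (\<xi> - \<eta>) = 0" by (simp add: clinear_diff[OF hilbert_iso_linear])
  then show "\<xi> = \<eta>" using hilbert_iso_norm[of "\<xi> - \<eta>"] by simp
qed

lemma hilbert_iso_inv_left: "inv_into UNIV f (f \<xi>) = \<xi>"
  by (rule inv_f_f[OF hilbert_iso_inj])

lemma hilbert_iso_inv_right: "f (inv_into UNIV f \<eta>) = \<eta>"
  by (rule surj_f_inv_f[OF hilbert_iso_surj])

text \<open>Polarization: the norms of \<xi>, \<eta> and their sum are preserved, and they determine
  the real part of the inner product.\<close>

lemma hilbert_iso_Re_cinner: "Re (cinner (f \<xi>) (f \<eta>)) = Re (cinner \<xi> \<eta>)"
  using norm_add_sq[of "f \<xi>" "f \<eta>"] norm_add_sq[of \<xi> \<eta>]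
  by (simp add: hilbert_iso_norm clinear_add[OF hilbert_iso_linear, symmetric])

lemma hilbert_iso_cinner: "cinner (f \<xi>) (f \<eta>) = cinner \<xi> \<eta>"
proof (rule complex_eqI)
  \<comment> \<open>Multiplying \<xi> by the imaginary unit turns the imaginary part of the inner
    product into a real part, up to sign.\<close>
  show "Im (cinner (f \<xi>) (f \<eta>)) = Im (cinner \<xi> \<eta>)"
    using hilbert_iso_Re_cinner[of "\<i> *\<^sub>C \<xi>" \<eta>]
    by (simp add: clinear_scaleC[OF hilbert_iso_linear] cinner_scaleC_left)
qed (rule hilbert_iso_Re_cinner)

lemma hilbert_iso_inv: "hilbert_isomorphism (inv_into UNIV f)"
  unfolding hilbert_isomorphism_def
proof (intro conjI allI clinearI)
  show "inv_into UNIV f (x + y) = inv_into UNIV f x + inv_into UNIV f y" for x y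
    by (rule injD[OF hilbert_iso_inj])
      (simp add: clinear_add[OF hilbert_iso_linear] hilbert_iso_inv_right)
  show "inv_into UNIV f (c *\<^sub>C x) = c *\<^sub>C inv_into UNIV f x" for c x
    by (rule injD[OF hilbert_iso_inj])
      (simp add: clinear_scaleC[OF hilbert_iso_linear] hilbert_iso_inv_right)
  show "surj (inv_into UNIV f)" by (rule inj_imp_surj_inv[OF hilbert_iso_inj])
  show "norm (inv_into UNIV f x) = norm x" for x
    using hilbert_iso_norm[of "inv_into UNIV f x"] by (simp add: hilbert_iso_inv_right)
qed

lemma cinner_hilbert_iso_inv: "cinner (inv_into UNIV f \<eta>) \<xi> = cinner \<eta> (f \<xi>)"
  using hilbert_iso_cinner[of "inv_into UNIV f \<eta>" \<xi>] by (simp add: hilbert_iso_inv_right)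

end

lemma clinear_contraction_op:
  assumes "\<And>x y. T (x + y) = T x + T y" "\<And>c x. T (c *\<^sub>C x) = c *\<^sub>C T x"
    and "\<And>x. norm (T x) \<le> norm x"
  shows "T \<in> bounded_operators"
proof (rule bounded_operatorsI[OF bounded_linear_intro])
  show "T (r *\<^sub>R x) = r *\<^sub>R T x" for r x by (metis assms(2) scaleC_of_real)
  show "norm (T x) \<le> norm x * 1" for x using assms(3) by simp
qed (rule assms)+

lemma hilbert_iso_op: "hilbert_isomorphism T \<Longrightarrow> T \<in> bounded_operators"
  by (intro clinear_contraction_op)
    (simp_all add: hilbert_iso_norm clinear_add clinear_scaleC hilbert_iso_linear)

lemma adjoint_ops_hilbert_iso: "hilbert_isomorphism T \<Longrightarrow> adjoint_ops T (inv_into UNIV T)"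
  by (simp add: adjoint_ops_def cinner_hilbert_iso_inv)

section \<open>Cuntz families of isometries\<close>

locale cuntz_family =
  fixes T T' :: "'x::finite \<Rightarrow> 'h::complex_hilbert_space \<Rightarrow> 'h"
  assumes T: "T x \<in> bounded_operators"
    and T': "T' x \<in> bounded_operators"
    and adjoint: "adjoint_ops (T x) (T' x)"
    and isometry: "T' x (T x \<xi>) = \<xi>"
    and resolution: "(\<Sum>x\<in>UNIV. T x (T' x \<xi>)) = \<xi>"
begin

lemma norm_T: "norm (T x \<xi>) = norm \<xi>"
proof (rule power2_eq_imp_eq)
  show "(norm (T x \<xi>))\<^sup>2 = (norm \<xi>)\<^sup>2"
    by (simp add: norm_sq_eq_Re adjoint_opsD[OF adjoint, symmetric] isometry)
qed simp_all

text \<open>A Parseval identity: moving each \<open>T' x\<close> across the inner product leaves the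
  resolution of the identity. It serves both the orthogonality of ranges and the isometry of
  \<open>similarity_of\<close>.\<close>

lemma sum_norm_T': "(\<Sum>x\<in>UNIV. (norm (T' x \<xi>))\<^sup>2) = (norm \<xi>)\<^sup>2"
proof -
  have "(\<Sum>x\<in>UNIV. (norm (T' x \<xi>))\<^sup>2) = Re (\<Sum>x\<in>UNIV. cinner \<xi> (T x (T' x \<xi>)))"
    by (simp add: norm_sq_eq_Re adjoint_opsD[OF adjoint])
  also have "\<dots> = (norm \<xi>)\<^sup>2"
    by (simp add: cinner_sum_right[symmetric] resolution norm_sq_eq_Re)
  finally show ?thesis .
qed

text \<open>For \<open>T x \<xi>\<close> the term at \<open>x\<close> in the Parseval sum already
  accounts for the whole squared norm, so the term at any other letter vanishes.\<close>

lemma orthogonal: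
  assumes "x \<noteq> y"
  shows "T' y (T x \<xi>) = 0"
proof -
  have "(norm (T' x (T x \<xi>)))\<^sup>2 + (norm (T' y (T x \<xi>)))\<^sup>2
      = (\<Sum>z\<in>{x, y}. (norm (T' z (T x \<xi>)))\<^sup>2)"
    using assms by simp
  also have "\<dots> \<le> (\<Sum>z\<in>UNIV. (norm (T' z (T x \<xi>)))\<^sup>2)"
    by (rule sum_mono2) auto
  also have "\<dots> = (norm (T x \<xi>))\<^sup>2" by (rule sum_norm_T')
  finally show ?thesis by (simp add: isometry norm_T)
qed

lemma not_finite_dimensional:
  assumes "CARD('x) \<ge> 2" "\<exists>\<xi>::'h. \<xi> \<noteq> 0" "finite B0"
  shows "complex_vector.span B0 \<noteq> (UNIV :: 'h set)"
proof
  assume B0: "complex_vector.span B0 = (UNIV :: 'h set)"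
  obtain B where B: "B \<subseteq> B0" "complex_vector.independent B" "B0 \<subseteq> complex_vector.span B"
    by (rule complex_vector.maximal_independent_subset)
  have "complex_vector.span B = UNIV"
    using complex_vector.span_mono[OF B(3)] B0 by (simp add: complex_vector.span_span top.extremum_unique)
  then interpret fd: finite_dimensional_vector_space "(*\<^sub>C) :: complex \<Rightarrow> 'h \<Rightarrow> 'h" B
    using B assms(3) by unfold_locales (auto intro: finite_subset)
  obtain x y :: 'x where xy: "x \<noteq> y"
    using assms(1) by (metis UNIV_I card_2_iff' ex_card)
  have "inj (T x)" by (metis injI isometry)
  then have "surj (T x)" by (rule fd.linear_inj_imp_surj[OF op_linear[OF T]])
  \<comment> \<open>Every vector would lie in the range of \<open>T x\<close>, on which
    \<open>T' y\<close> vanishes. Since \<open>T' y\<close> also undoes \<open>T y\<close>, the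
    whole space would be zero.\<close>
  then have "T' y \<xi> = 0" for \<xi> by (metis orthogonal[OF xy] surjD)
  then have "(\<xi>::'h) = 0" for \<xi> by (metis isometry)
  then show False using assms(2) by blast
qed

definition similarity_of :: "'h \<Rightarrow> 'h^'x" where
  "similarity_of \<xi> = (\<chi> x. T' x \<xi>)"

lemma T'_sum_T: "T' y (\<Sum>x\<in>UNIV. T x (v $ x)) = v $ y"
proof -
  have "T' y (T x (v $ x)) = (if x = y then v $ y else 0)" for x
    using orthogonal isometry by auto
  then show ?thesis by (simp add: op_sum[OF T'])
qed

lemma hilbert_iso_similarity_of: "hilbert_isomorphism similarity_of"
  unfolding hilbert_isomorphism_def
proof (intro conjI allI clinearI)
  show "similarity_of (x + y) = similarity_of x + similarity_of y" for x y
    by (simp add: similarity_of_def vec_eq_iff op_add[OF T'])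
  show "similarity_of (c *\<^sub>C x) = c *\<^sub>C similarity_of x" for c x
    by (simp add: similarity_of_def vec_eq_iff scaleC_vec_def op_scaleC[OF T'])
  show "surj similarity_of"
    by (rule surjI[of _ "\<lambda>v. \<Sum>x\<in>UNIV. T x (v $ x)"]) (simp add: similarity_of_def vec_eq_iff T'_sum_T)
  show "norm (similarity_of x) = norm x" for x
    by (simp add: similarity_of_def norm_vec_def L2_set_def sum_norm_T')
qed

lemma similarity_similarity_of:
  "CARD('x) \<ge> 2 \<Longrightarrow> \<exists>\<xi>::'h. \<xi> \<noteq> 0 \<Longrightarrow> similarity similarity_of"
  using not_finite_dimensional hilbert_iso_similarity_of by (auto simp: similarity_def)

text \<open>By orthogonality and the isometry relation the coordinates of \<open>T x \<xi>\<close>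
  form the axis vector at \<open>x\<close>, so the inverse of \<open>similarity_of\<close> returns
  \<open>T x \<xi>\<close>.\<close>

lemma isometry_of_similarity_of: "isometry_of similarity_of x = T x"
proof
  fix \<xi>
  have "similarity_of (T x \<xi>) = axis x \<xi>"
    using orthogonal isometry by (auto simp: similarity_of_def vec_eq_iff axis_def)
  then show "isometry_of similarity_of x \<xi> = T x \<xi>"
    unfolding isometry_of_def by (metis hilbert_iso_inv_left[OF hilbert_iso_similarity_of])
qed

end

text \<open>Were the space zero, the empty set would span it, against infinite dimension.\<close>

lemma similarity_nonzero: "similarity (\<psi> :: 'h::complex_hilbert_space \<Rightarrow> 'h^'x::finite) \<Longrightarrow> \<exists>\<xi>::'h. \<xi> \<noteq> 0"
  by (auto simp: similarity_def dest!: spec[of _ "{}"])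

text \<open>The adjoint of the isometry at \<open>x\<close> is the coordinate of \<psi> at
  \<open>x\<close>: the inverse of \<psi> is adjoint to \<psi>, and \<open>axis x\<close> is adjoint
  to the projection onto that coordinate.\<close>

lemma cuntz_family_isometry_of:
  fixes \<psi> :: "'h::complex_hilbert_space \<Rightarrow> 'h^'x::finite"
  assumes "hilbert_isomorphism \<psi>"
  shows "cuntz_family (isometry_of \<psi>) (\<lambda>x \<xi>. \<psi> \<xi> $ x)"
proof
  note lin = hilbert_iso_linear[OF assms]
  note inv = hilbert_iso_inv[OF assms]
  note inv_lin = hilbert_iso_linear[OF inv]
  have norm_axis: "norm (axis x \<xi> :: 'h^'x) = norm \<xi>" for x \<xi>
  proof -
    have "(\<Sum>i\<in>UNIV. (norm (if i = x then \<xi> else 0))\<^sup>2) = (\<Sum>i\<in>UNIV. if i = x then (norm \<xi>)\<^sup>2 else 0)"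
      by (rule sum.cong) auto
    then show ?thesis by (simp add: norm_vec_def L2_set_def axis_def)
  qed
  fix x and \<xi> :: 'h
  show "isometry_of \<psi> x \<in> bounded_operators"
  proof (rule clinear_contraction_op)
    have "axis x (\<xi> + \<eta>) = (axis x \<xi> + axis x \<eta> :: 'h^'x)" for \<xi> \<eta>
      by (simp add: vec_eq_iff axis_def)
    then show "isometry_of \<psi> x (\<xi> + \<eta>) = isometry_of \<psi> x \<xi> + isometry_of \<psi> x \<eta>" for \<xi> \<eta>
      by (simp add: isometry_of_def clinear_add[OF inv_lin])
    have "axis x (c *\<^sub>C \<xi>) = (c *\<^sub>C axis x \<xi> :: 'h^'x)" for c \<xi>
      by (simp add: vec_eq_iff axis_def scaleC_vec_def)
    then show "isometry_of \<psi> x (c *\<^sub>C \<xi>) = c *\<^sub>C isometry_of \<psi> x \<xi>" for c \<xi>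
      by (simp add: isometry_of_def clinear_scaleC[OF inv_lin])
    show "norm (isometry_of \<psi> x \<xi>) \<le> norm \<xi>" for \<xi>
      by (simp add: isometry_of_def hilbert_iso_norm[OF inv] norm_axis)
  qed
  show "(\<lambda>\<xi>. \<psi> \<xi> $ x) \<in> bounded_operators"
  proof (rule clinear_contraction_op)
    show "norm (\<psi> \<xi> $ x) \<le> norm \<xi>" for \<xi>
      using Finite_Cartesian_Product.norm_nth_le[of "\<psi> \<xi>" x] by (simp add: hilbert_iso_norm[OF assms])
  qed (simp_all add: clinear_add[OF lin] clinear_scaleC[OF lin] scaleC_vec_def)
  have "cinner (axis x \<eta>) v = cinner \<eta> (v $ x)" for \<eta> and v :: "'h^'x"
  proof -
    have "cinner (axis x \<eta>) v = (\<Sum>i\<in>UNIV. if i = x then cinner \<eta> (v $ i) else 0)"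
      unfolding cinner_vec_def by (rule sum.cong) (auto simp: axis_def)
    then show ?thesis by simp
  qed
  then have "adjoint_ops (\<lambda>\<xi>. \<psi> \<xi> $ x) (isometry_of \<psi> x)"
    by (simp add: adjoint_ops_def isometry_of_def cinner_hilbert_iso_inv[OF assms])
  then show "adjoint_ops (isometry_of \<psi> x) (\<lambda>\<xi>. \<psi> \<xi> $ x)"
    by (rule adjoint_ops_sym)
  show "\<psi> (isometry_of \<psi> x \<xi>) $ x = \<xi>"
    by (simp add: isometry_of_def hilbert_iso_inv_right[OF assms])
  have "(\<Sum>x\<in>UNIV. axis x (\<psi> \<xi> $ x)) = \<psi> \<xi>"
    by (simp add: vec_eq_iff axis_def)
  then show "(\<Sum>x\<in>UNIV. isometry_of \<psi> x (\<psi> \<xi> $ x)) = \<xi>"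
    unfolding isometry_of_def clinear_sum[OF inv_lin, symmetric]
    by (simp add: hilbert_iso_inv_left[OF assms])
qed

text \<open>The naming \<open>a\<close> of the generators stays arbitrary so that the result serves
  the Cuntz algebra with \<open>id\<close> and the Cuntz-Pimsner algebra with
  \<open>Inr\<close>.\<close>

lemma (in operator_family) cuntz_relators_vanish:
  assumes "cuntz_family (\<lambda>x. T (a x)) (\<lambda>x. T' (a x))" "range a \<subseteq> S" "r \<in> cuntz_relators a"
  shows "poly_op T T' r = (\<lambda>_. 0)"
proof -
  interpret cuntz_family "\<lambda>x. T (a x)" "\<lambda>x. T' (a x)" by (rule assms(1))
  have "a x \<in> S" for x using assms(2) by blast
  then show ?thesis
    using assms(3)
    by (auto simp: cuntz_relators_def fun_eq_iff poly_op_diff poly_op_sum poly_op_mult isometry resolution)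
qed

section \<open>Representations of universal algebras\<close>

text \<open>Unitaries and isometries alike satisfy this relation, so the criterion covers every
  generator of both algebras, with the bound 1.\<close>

lemma bounded_relationsI:
  assumes "\<And>s. s \<in> S \<Longrightarrow> poly_star (gen s) * gen s - 1 \<in> R"
  shows "bounded_relations S R"
proof
  fix s assume "s \<in> S"
  then show "\<exists>c. \<forall>p. cstar_seminorm S p \<longrightarrow> (\<forall>r\<in>R. p r = 0) \<longrightarrow> p (gen s) \<le> c"
    using assms by (intro exI[of _ 1]) (auto intro: seminorm_isometry_le)
qed

locale universal_representation = bounded_relations S R for S :: "'s set" and R +
  fixes \<Phi> :: "(nat \<Rightarrow> 's star_poly) set \<Rightarrow> 'h::complex_hilbert_space \<Rightarrow> 'h"
  assumes rep: "star_representation A \<Phi>"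
begin

text \<open>The representation is pulled back to the free algebra along constant sequences; there
  the relators give plain identities between operators.\<close>

definition rep_op :: "'s star_poly \<Rightarrow> 'h \<Rightarrow> 'h" where
  "rep_op a = \<Phi> (cls (\<lambda>_. a))"

lemma rep_nonzero: "\<exists>\<xi>::'h. \<xi> \<noteq> 0"
  using rep by (simp add: star_representation_def)

lemma rep_universal_gen: "\<Phi> (universal_gen S R s) = rep_op (gen s)"
  by (simp add: rep_op_def universal_gen_cls)

context
  fixes a assumes a: "a \<in> F"
begin

lemma rep_carrier: "cls (\<lambda>_. a) \<in> carrier A"
  by (rule cls_carrier[OF const_cauchy[OF a]])

lemma rep_op_bounded: "rep_op a \<in> bounded_operators"
  using rep rep_carrier by (simp add: star_representation_def rep_op_def)

lemma rep_op_add: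
  assumes b: "b \<in> F"
  shows "rep_op (a + b) \<xi> = rep_op a \<xi> + rep_op b \<xi>"
  using rep cls_carrier[OF const_cauchy[OF a]] cls_carrier[OF const_cauchy[OF b]]
  by (simp add: star_representation_def rep_op_def add_cls(2)[OF const_cauchy[OF a] const_cauchy[OF b], symmetric])

lemma rep_op_mult:
  assumes b: "b \<in> F"
  shows "rep_op (a * b) \<xi> = rep_op a (rep_op b \<xi>)"
  using rep cls_carrier[OF const_cauchy[OF a]] cls_carrier[OF const_cauchy[OF b]]
  by (simp add: star_representation_def rep_op_def mult_cls(2)[OF const_cauchy[OF a] const_cauchy[OF b], symmetric])

lemma rep_op_adjoint: "adjoint_ops (rep_op a) (rep_op (poly_star a))"
  using rep rep_carrier
  by (simp add: star_representation_def rep_op_def adjoint_ops_def star_cls(2)[OF const_cauchy[OF a], symmetric])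

end

lemma rep_op_one: "rep_op 1 \<xi> = \<xi>"
  using rep by (simp add: star_representation_def rep_op_def one_cls)

lemma rep_op_zero: "rep_op 0 \<xi> = 0"
  using rep_op_add[of 0 0 \<xi>] by simp

lemma rep_op_sum: "(\<And>i. i \<in> I \<Longrightarrow> f i \<in> F) \<Longrightarrow> rep_op (sum f I) \<xi> = (\<Sum>i\<in>I. rep_op (f i) \<xi>)"
  by (induction I rule: infinite_finite_induct) (simp_all add: rep_op_zero rep_op_add)

lemma rep_op_relator: "a - b \<in> R \<Longrightarrow> a \<in> F \<Longrightarrow> b \<in> F \<Longrightarrow> rep_op a = rep_op b"
  by (simp add: rep_op_def relator_cls)

lemma cuntz_family_rep_op:
  assumes "cuntz_relators a \<subseteq> R" "range a \<subseteq> S"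
  shows "cuntz_family (\<lambda>x. rep_op (gen (a x))) (\<lambda>x. rep_op (poly_star (gen (a x))))"
proof
  fix x \<xi>
  have S: "a y \<in> S" for y using assms(2) by blast
  then have F: "gen (a y) \<in> F" "poly_star (gen (a y)) \<in> F" for y by auto
  show "rep_op (gen (a x)) \<in> bounded_operators" "rep_op (poly_star (gen (a x))) \<in> bounded_operators"
    using F by (simp_all add: rep_op_bounded)
  show "adjoint_ops (rep_op (gen (a x))) (rep_op (poly_star (gen (a x))))"
    by (rule rep_op_adjoint[OF F(1)])
  have "poly_star (gen (a x)) * gen (a x) - 1 \<in> R"
    using assms(1) by (auto simp: cuntz_relators_def)
  from rep_op_relator[OF this]
  show "rep_op (poly_star (gen (a x))) (rep_op (gen (a x)) \<xi>) = \<xi>"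
    using F by (simp add: rep_op_mult[symmetric] rep_op_one)
  have "(\<Sum>x\<in>UNIV. gen (a x) * poly_star (gen (a x))) - 1 \<in> R"
    using assms(1) by (auto simp: cuntz_relators_def)
  from rep_op_relator[OF this]
  have "rep_op (\<Sum>x\<in>UNIV. gen (a x) * poly_star (gen (a x))) \<xi> = \<xi>"
    using F by (simp add: rep_op_one)
  then show "(\<Sum>x\<in>UNIV. rep_op (gen (a x)) (rep_op (poly_star (gen (a x))) \<xi>)) = \<xi>"
    using F by (simp add: rep_op_sum rep_op_mult)
qed

text \<open>The two relators play different roles: the one with the adjoint on the right gives
  surjectivity, the other gives preservation of the norm.\<close>

lemma unitary_rep_op:
  assumes "s \<in> S" "poly_star (gen s) * gen s - 1 \<in> R" "gen s * poly_star (gen s) - 1 \<in> R"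
  shows "hilbert_isomorphism (rep_op (gen s))"
  unfolding hilbert_isomorphism_def
proof (intro conjI allI)
  have F: "gen s \<in> F" "poly_star (gen s) \<in> F" using assms(1) by auto
  show "Vector_Spaces.linear (*\<^sub>C) (*\<^sub>C) (rep_op (gen s))"
    by (rule op_linear[OF rep_op_bounded[OF F(1)]])
  have "rep_op (gen s) (rep_op (poly_star (gen s)) \<xi>) = \<xi>" for \<xi>
    using rep_op_relator[OF assms(3)] F by (simp add: rep_op_mult[symmetric] rep_op_one)
  then show "surj (rep_op (gen s))" by (metis surjI)
  have "rep_op (poly_star (gen s)) (rep_op (gen s) \<xi>) = \<xi>" for \<xi>
    using rep_op_relator[OF assms(2)] F by (simp add: rep_op_mult[symmetric] rep_op_one)
  then have "(norm (rep_op (gen s) \<xi>))\<^sup>2 = (norm \<xi>)\<^sup>2" for \<xi>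
    by (simp add: norm_sq_eq_Re adjoint_opsD[OF rep_op_adjoint[OF F(1)], symmetric])
  then show "norm (rep_op (gen s) \<xi>) = norm \<xi>" for \<xi>
    by (rule power2_eq_imp_eq) simp_all
qed

end

section \<open>The Cuntz algebra and the Cuntz-Pimsner algebra\<close>

text \<open>\<open>cuntz_representation\<close> is a choice, so its values on generators are known
  once the universal property shows that a suitable representation exists.\<close>

lemma cuntz_representation_gen:
  fixes \<psi> :: "'h::complex_hilbert_space \<Rightarrow> 'h^'x::finite"
  assumes "similarity \<psi>"
  shows "cuntz_representation \<psi> (cuntz_gen x) = isometry_of \<psi> x"
proof -
  let ?T' = "\<lambda>x \<xi>. \<psi> \<xi> $ x"
  have iso: "hilbert_isomorphism \<psi>" using assms by (simp add: similarity_def)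
  interpret cuntz_family "isometry_of \<psi>" ?T'
    by (rule cuntz_family_isometry_of[OF iso])
  interpret bounded_relations "UNIV :: 'x set" "cuntz_relators id"
    by (rule bounded_relationsI) (auto simp: cuntz_relators_def)
  interpret operator_family UNIV "isometry_of \<psi>" ?T'
    by standard (rule T T' adjoint)+
  interpret relation_model UNIV "cuntz_relators id" "isometry_of \<psi>" ?T'
  proof
    show "poly_op (isometry_of \<psi>) ?T' r = (\<lambda>_. 0)" if "r \<in> cuntz_relators id" for r
      using cuntz_relators_vanish[OF _ _ that] cuntz_family_axioms by simp
  qed (rule similarity_nonzero[OF assms])
  have "\<exists>\<pi>. star_representation cuntz_algebra \<pi> \<and> (\<forall>x. \<pi> (cuntz_gen x) = isometry_of \<psi> x)"
    using universal_property by (simp add: cuntz_algebra_def cuntz_gen_def)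
  from someI_ex[OF this] show ?thesis by (simp add: cuntz_representation_def)
qed

lemma bounded_cuntz_pimsner: "bounded_relations (cuntz_pimsner_gens G) (cuntz_pimsner_relators G act)"
  by (rule bounded_relationsI)
    (auto simp: cuntz_pimsner_gens_def cuntz_pimsner_relators_def group_relators_def cuntz_relators_def)

lemma self_similar_group_group: "self_similar_group G act \<Longrightarrow> Group.group G"
  by (simp add: self_similar_group_def faithful_action_def group_action_def group_hom_def)

lemma cuntz_pimsner_representation_exists:
  fixes G :: "('g, 'm) monoid_scheme" and act :: "'g \<Rightarrow> 'x::finite list \<Rightarrow> 'x list"
    and \<psi> :: "'h::complex_hilbert_space \<Rightarrow> 'h^'x"
  assumes G: "Group.group G" and \<psi>: "similarity \<psi>" and \<rho>: "unitary_representation G \<rho>"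
    and ss: "self_similar_wrt G act \<psi> \<rho>"
  shows "\<exists>\<Phi>. star_representation (cuntz_pimsner_algebra G act) \<Phi> \<and>
    (\<forall>g\<in>carrier G. \<Phi> (cuntz_pimsner_unitary G act g) = \<rho> g) \<and>
    (\<forall>x. \<Phi> (cuntz_pimsner_isometry G act x) = isometry_of \<psi> x)"
proof -
  let ?T = "case_sum \<rho> (isometry_of \<psi>)"
  \<comment> \<open>The adjoint family consists of inverses for the unitaries and coordinates of
    \<psi> for the isometries.\<close>
  let ?T' = "case_sum (\<lambda>g. inv_into UNIV (\<rho> g)) (\<lambda>x \<xi>. \<psi> \<xi> $ x)"
  let ?S = "cuntz_pimsner_gens G :: ('g + 'x) set" and ?R = "cuntz_pimsner_relators G act"
  have iso: "hilbert_isomorphism \<psi>" using \<psi> by (simp add: similarity_def)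
  interpret cuntz_family "isometry_of \<psi>" "\<lambda>x \<xi>. \<psi> \<xi> $ x"
    by (rule cuntz_family_isometry_of[OF iso])
  interpret bounded_relations ?S ?R by (rule bounded_cuntz_pimsner)
  have unitary: "hilbert_isomorphism (\<rho> g)" if "g \<in> carrier G" for g
    using that \<rho> by (simp add: unitary_representation_def)
  have mult: "\<rho> (g \<otimes>\<^bsub>G\<^esub> h) \<xi> = \<rho> g (\<rho> h \<xi>)" if "g \<in> carrier G" "h \<in> carrier G" for g h \<xi>
    using that \<rho> by (simp add: unitary_representation_def)
  have one_carrier: "\<one>\<^bsub>G\<^esub> \<in> carrier G" using G by (simp add: Group.group_def monoid.one_closed)
  have m_closed: "g \<otimes>\<^bsub>G\<^esub> h \<in> carrier G" if "g \<in> carrier G" "h \<in> carrier G" for g h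
    using that G by (simp add: Group.group_def monoid.m_closed)
  have one: "\<rho> \<one>\<^bsub>G\<^esub> \<xi> = \<xi>" for \<xi>
  proof -
    \<comment> \<open>Preservation of the unit is derived from multiplicativity: the operator of the
      unit is idempotent, and injectivity cancels one factor.\<close>
    have "\<rho> \<one>\<^bsub>G\<^esub> (\<rho> \<one>\<^bsub>G\<^esub> \<xi>) = \<rho> \<one>\<^bsub>G\<^esub> \<xi>"
      using mult[OF one_carrier one_carrier, of \<xi>] G by (simp add: Group.group_def monoid.l_one one_carrier)
    then show ?thesis by (rule injD[OF hilbert_iso_inj[OF unitary[OF one_carrier]]])
  qed
  interpret operator_family ?S ?T ?T'
  proof
    fix s assume "s \<in> ?S"
    then consider g where "s = Inl g" "g \<in> carrier G" | x where "s = Inr x"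
      by (auto simp: cuntz_pimsner_gens_def)
    note cases = this
    show "?T s \<in> bounded_operators"
      by (rule cases) (simp_all add: T hilbert_iso_op unitary)
    show "?T' s \<in> bounded_operators"
      by (rule cases) (simp_all add: T' hilbert_iso_op hilbert_iso_inv unitary)
    show "adjoint_ops (?T s) (?T' s)"
      by (rule cases) (simp_all add: adjoint adjoint_ops_hilbert_iso unitary)
  qed
  have Inl_S: "Inl g \<in> ?S" if "g \<in> carrier G" for g
    using that by (simp add: cuntz_pimsner_gens_def)
  have Inr_S: "Inr x \<in> ?S" for x by (simp add: cuntz_pimsner_gens_def)
  interpret relation_model ?S ?R ?T ?T'
  proof
    fix r assume "r \<in> ?R"
    then consider "r \<in> group_relators G Inl" | "r \<in> cuntz_relators Inr"
      | g x y h where "r = gen (Inl g) * gen (Inr x) - gen (Inr y) * gen (Inl h)"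
        "g \<in> carrier G" "h \<in> carrier G" "wreath_relation act g x y h"
      by (auto simp: cuntz_pimsner_relators_def)
    then show "poly_op ?T ?T' r = (\<lambda>_. 0)"
    proof cases
      case 1
      then show ?thesis
        by (auto simp: group_relators_def fun_eq_iff poly_op_diff poly_op_mult Inl_S mult one
            hilbert_iso_inv_left hilbert_iso_inv_right unitary)
    next
      case 2
      show ?thesis
        by (rule cuntz_relators_vanish[OF _ _ 2]) (use cuntz_family_axioms Inr_S in auto)
    next
      case 3
      then have "\<rho> g (isometry_of \<psi> x \<xi>) = isometry_of \<psi> y (\<rho> h \<xi>)" for \<xi>
        using ss unfolding self_similar_wrt_def by (metis comp_apply)
      then show ?thesis
        by (simp add: 3 fun_eq_iff poly_op_diff poly_op_mult Inl_S Inr_S)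
    qed
  qed (rule similarity_nonzero[OF \<psi>])
  obtain \<Phi> :: "_ \<Rightarrow> 'h \<Rightarrow> 'h" where "star_representation A \<Phi>" "\<And>s. s \<in> ?S \<Longrightarrow> \<Phi> (universal_gen ?S ?R s) = ?T s"
    using universal_property by blast
  then show ?thesis
    by (intro exI[of _ \<Phi>])
      (simp add: cuntz_pimsner_algebra_def cuntz_pimsner_unitary_def cuntz_pimsner_isometry_def Inl_S Inr_S)
qed

section \<open>Restrictions of representations of the Cuntz-Pimsner algebra\<close>

locale cuntz_pimsner_representation =
  fixes G :: "('g, 'm) monoid_scheme" and act :: "'g \<Rightarrow> 'x::finite list \<Rightarrow> 'x list"
    and \<Phi> :: "(nat \<Rightarrow> ('g + 'x) star_poly) set \<Rightarrow> 'h::complex_hilbert_space \<Rightarrow> 'h"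
  assumes cp_rep: "star_representation (cuntz_pimsner_algebra G act) \<Phi>"
begin

sublocale universal_representation "cuntz_pimsner_gens G" "cuntz_pimsner_relators G act" \<Phi>
proof (rule universal_representation.intro[OF bounded_cuntz_pimsner])
  interpret bounded_relations "cuntz_pimsner_gens G" "cuntz_pimsner_relators G act"
    by (rule bounded_cuntz_pimsner)
  show "universal_representation_axioms (cuntz_pimsner_gens G) (cuntz_pimsner_relators G act) \<Phi>"
    by standard (use cp_rep in \<open>simp add: cuntz_pimsner_algebra_def\<close>)
qed

text \<open>Makes \<open>similarity_of\<close>, built from the adjoints of the images of the
  isometries, available as the similarity for the restricted representation.\<close>

sublocale cuntz_family "\<lambda>x. rep_op (gen (Inr x))" "\<lambda>x. rep_op (poly_star (gen (Inr x)))"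
  by (rule cuntz_family_rep_op) (auto simp: cuntz_pimsner_relators_def cuntz_pimsner_gens_def)

lemma unitary_eq: "\<Phi> (cuntz_pimsner_unitary G act g) = rep_op (gen (Inl g))"
  and isometry_eq: "\<Phi> (cuntz_pimsner_isometry G act x) = rep_op (gen (Inr x))"
  by (simp_all add: cuntz_pimsner_unitary_def cuntz_pimsner_isometry_def rep_universal_gen)

lemma Inl_free: "g \<in> carrier G \<Longrightarrow> gen (Inl g) \<in> F"
  and Inr_free: "gen (Inr x) \<in> F"
  by (simp_all add: cuntz_pimsner_gens_def)

lemma unitary_representation_restriction:
  assumes G: "Group.group G" and \<rho>: "\<And>g. g \<in> carrier G \<Longrightarrow> \<rho> g = \<Phi> (cuntz_pimsner_unitary G act g)"
  shows "unitary_representation G \<rho>"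
  unfolding unitary_representation_def
proof (intro conjI ballI)
  fix g assume g: "g \<in> carrier G"
  show "hilbert_isomorphism (\<rho> g)"
    unfolding \<rho>[OF g] unitary_eq using g
    by (intro unitary_rep_op) (auto simp: cuntz_pimsner_gens_def cuntz_pimsner_relators_def group_relators_def)
  fix h assume h: "h \<in> carrier G"
  have gh: "g \<otimes>\<^bsub>G\<^esub> h \<in> carrier G" using G g h by (simp add: Group.group_def monoid.m_closed)
  have "gen (Inl g) * gen (Inl h) - gen (Inl (g \<otimes>\<^bsub>G\<^esub> h)) \<in> cuntz_pimsner_relators G act"
    using g h by (auto simp: cuntz_pimsner_relators_def group_relators_def)
  from rep_op_relator[OF this] show "\<rho> (g \<otimes>\<^bsub>G\<^esub> h) = \<rho> g \<circ> \<rho> h"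
    using g h gh by (auto simp: \<rho> unitary_eq Inl_free rep_op_mult fun_eq_iff)
qed

lemma wreath_relation_restriction:
  assumes g: "g \<in> carrier G" and h: "h \<in> carrier G" and "wreath_relation act g x y h"
  shows "\<Phi> (cuntz_pimsner_unitary G act g) \<circ> \<Phi> (cuntz_pimsner_isometry G act x)
    = \<Phi> (cuntz_pimsner_isometry G act y) \<circ> \<Phi> (cuntz_pimsner_unitary G act h)"
proof -
  have "gen (Inl g) * gen (Inr x) - gen (Inr y) * gen (Inl h) \<in> cuntz_pimsner_relators G act"
    using assms by (auto simp: cuntz_pimsner_relators_def)
  from rep_op_relator[OF this] show ?thesis
    unfolding unitary_eq isometry_eq using g h
    by (auto simp: Inl_free Inr_free rep_op_mult[symmetric] fun_eq_iff)
qed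

text \<open>Shared by both converse directions: one applies it to the given \<psi>, the other to
  \<open>similarity_of\<close>.\<close>

lemma self_similar_wrt_restriction:
  assumes "\<And>g. g \<in> carrier G \<Longrightarrow> \<Phi> (cuntz_pimsner_unitary G act g) = \<rho> g"
    and "\<And>x. \<Phi> (cuntz_pimsner_isometry G act x) = isometry_of \<psi> x"
  shows "self_similar_wrt G act \<psi> \<rho>"
  using wreath_relation_restriction assms by (simp add: self_similar_wrt_def)

end

theorem proposition3p2:
  fixes G :: "('g, 'm) monoid_scheme" and act :: "'g \<Rightarrow> 'x::finite list \<Rightarrow> 'x list"
  assumes "self_similar_group G act" and "CARD('x) \<ge> 2"
  shows "(\<forall>(\<psi> :: 'h::complex_hilbert_space \<Rightarrow> 'h^'x) \<rho>.
            similarity \<psi> \<longrightarrow> unitary_representation G \<rho> \<longrightarrow>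
            (self_similar_wrt G act \<psi> \<rho> \<longleftrightarrow>
              (\<exists>\<Phi>. star_representation (cuntz_pimsner_algebra G act) \<Phi> \<and>
                (\<forall>g\<in>carrier G. \<Phi> (cuntz_pimsner_unitary G act g) = \<rho> g) \<and>
                (\<forall>x. \<Phi> (cuntz_pimsner_isometry G act x) = cuntz_representation \<psi> (cuntz_gen x)))))
       \<and> (\<forall>\<rho> :: 'g \<Rightarrow> 'h \<Rightarrow> 'h.
            self_similar_representation G act \<rho> \<longleftrightarrow>
              (\<exists>\<Phi>. star_representation (cuntz_pimsner_algebra G act) \<Phi> \<and>
                (\<forall>g\<in>carrier G. \<Phi> (cuntz_pimsner_unitary G act g) = \<rho> g)))"
proof (intro conjI allI impI iffI)
  note G = self_similar_group_group[OF assms(1)]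
  {
    fix \<psi> :: "'h \<Rightarrow> 'h^'x" and \<rho> :: "'g \<Rightarrow> 'h \<Rightarrow> 'h"
    assume \<psi>: "similarity \<psi>" and \<rho>: "unitary_representation G \<rho>"
    {
      assume "self_similar_wrt G act \<psi> \<rho>"
      from cuntz_pimsner_representation_exists[OF G \<psi> \<rho> this]
      show "\<exists>\<Phi>. star_representation (cuntz_pimsner_algebra G act) \<Phi> \<and>
          (\<forall>g\<in>carrier G. \<Phi> (cuntz_pimsner_unitary G act g) = \<rho> g) \<and>
          (\<forall>x. \<Phi> (cuntz_pimsner_isometry G act x) = cuntz_representation \<psi> (cuntz_gen x))"
        by (simp add: cuntz_representation_gen[OF \<psi>])
    next
      assume "\<exists>\<Phi>. star_representation (cuntz_pimsner_algebra G act) \<Phi> \<and>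
          (\<forall>g\<in>carrier G. \<Phi> (cuntz_pimsner_unitary G act g) = \<rho> g) \<and>
          (\<forall>x. \<Phi> (cuntz_pimsner_isometry G act x) = cuntz_representation \<psi> (cuntz_gen x))"
      then obtain \<Phi> where \<Phi>: "star_representation (cuntz_pimsner_algebra G act) \<Phi>"
        "\<forall>g\<in>carrier G. \<Phi> (cuntz_pimsner_unitary G act g) = \<rho> g"
        "\<forall>x. \<Phi> (cuntz_pimsner_isometry G act x) = isometry_of \<psi> x"
        by (auto simp: cuntz_representation_gen[OF \<psi>])
      interpret cuntz_pimsner_representation G act \<Phi> by standard (rule \<Phi>(1))
      show "self_similar_wrt G act \<psi> \<rho>"
        using \<Phi>(2,3) by (intro self_similar_wrt_restriction) auto
    }
  }
  fix \<rho> :: "'g \<Rightarrow> 'h \<Rightarrow> 'h"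
  {
    assume "self_similar_representation G act \<rho>"
    then obtain \<psi> :: "'h \<Rightarrow> 'h^'x" where
      "unitary_representation G \<rho>" "similarity \<psi>" "self_similar_wrt G act \<psi> \<rho>"
      by (auto simp: self_similar_representation_def)
    \<comment> \<open>The prescribed values on the isometries are forgotten; the restriction to the
      group is all that remains.\<close>
    from cuntz_pimsner_representation_exists[OF G this(2,1,3)]
    show "\<exists>\<Phi>. star_representation (cuntz_pimsner_algebra G act) \<Phi> \<and>
        (\<forall>g\<in>carrier G. \<Phi> (cuntz_pimsner_unitary G act g) = \<rho> g)"
      by blast
  next
    assume "\<exists>\<Phi>. star_representation (cuntz_pimsner_algebra G act) \<Phi> \<and>
        (\<forall>g\<in>carrier G. \<Phi> (cuntz_pimsner_unitary G act g) = \<rho> g)"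
    then obtain \<Phi> where \<Phi>: "star_representation (cuntz_pimsner_algebra G act) \<Phi>"
      "\<forall>g\<in>carrier G. \<Phi> (cuntz_pimsner_unitary G act g) = \<rho> g" by blast
    interpret cuntz_pimsner_representation G act \<Phi> by standard (rule \<Phi>(1))
    have "unitary_representation G \<rho>"
      using \<Phi>(2) by (intro unitary_representation_restriction[OF G]) simp
    \<comment> \<open>No similarity is given in this direction. The one built from \<Phi> qualifies
      because two distinct letters and a nonzero vector force infinite dimension.\<close>
    moreover have "similarity similarity_of"
      by (rule similarity_similarity_of[OF assms(2) rep_nonzero])
    moreover have "self_similar_wrt G act similarity_of \<rho>"
      using \<Phi>(2) by (intro self_similar_wrt_restriction) (auto simp: isometry_of_similarity_of isometry_eq)
    ultimately show "self_similar_representation G act \<rho>"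
      by (auto simp: self_similar_representation_def)
  }
qed

end
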